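(* There exists a construction of an optical priority queue with buffer $2^{\Theta(\sqrt{M})}$ using a single $(M+2)\times(M+2)$ crossbar switch and $M$ fiber delay lines, arranged as follows: one switch input is the external arrival link, one switch output is the departure link, one switch output is the loss link, and the $M$ FDLs connect the remaining $M$ switch outputs to the remaining $M$ switch inputs in pairs.
   Context: Time is slotted, packets have fixed size and one packet traverses a link in one slot. An $n\times n$ (optical) crossbar switch is a memoryless element that at each slot connects its inputs to its outputs by any permutation chosen by its routing policy (which may be controlled by a controller issuing departure requests), packets passing instantaneously. A fiber delay line (FDL) with delay $d$ (a nonnegative integer) delivers a packet entering at time $t$ to its output at time $t+d$. The buffer size being $2^{\Theta(\sqrt M)}$ means that the constructions are given for an infinite set of values of $M$ and their buffer sizes $B(M)$ satisfy $2^{c_1\sqrt M}\le B(M)\le 2^{c_2\sqrt M}$ for some positive constants $c_1,c_2$ and all sufficiently large such $M$. Priority queue with buffer $B$: each arriving packet carries a unique priority; if at the beginning of time $t$ there are $k$ packets in the element (including the arriving one, if any) and packet $i$ has the $j$-th highest priority among them, its tag is $\tau_i(t)=j$. With $a(t),d(t),l(t)\in\{0,1\}$ the states of the arrival, departure and loss links, $c(t)\in\{0,1\}$ indicating a departure request and $q(t)$ the number of buffered packets, starting empty at time $0$, for all $t>0$: (P1) $q(t)=q(t-1)+a(t)-d(t)-l(t)$; (P2) $d(t)=1$ iff $c(t)=1$ and $q(t-1)+a(t)>0$; (P3) $l(t)=1$ iff $c(t)=0$, $q(t-1)=B$, $a(t)=1$; (P4) a departing packet $i$ at $t$ has $\tau_i(t)=1$;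 (P5) a lost packet $i$ at $t$ has $\tau_i(t)=B+1$. An optical priority queue is such a priority queue built from crossbar switches and FDLs. *)

theory Defs
  imports Complex_Main
begin

text \<open>Port conventions for the single (M+2) x (M+2) crossbar switch.
  Switch inputs {0..M+1}: input 0 is the external arrival link, input i (1 \<le> i \<le> M)
  is the output end of FDL i, input M+1 is unused (idle).
  Switch outputs {0..M+1}: output 0 is the departure link, output M+1 is the loss link,
  output j (1 \<le> j \<le> M) feeds the input end of FDL j.
  A routing decision at slot t is a permutation \<sigma> t of {0..M+1}: input k is connected
  to output \<sigma> t k.  FDL j has delay d j.
  Packets are identified with their (unique) priorities, of a linearly ordered type;
  a larger value means a higher priority.\<close>

function inp :: "nat \<Rightarrow> (nat \<Rightarrow> nat) \<Rightarrow> (nat \<Rightarrow> nat \<Rightarrow> nat) \<Rightarrow> (nat \<Rightarrow> 'p option)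
                 \<Rightarrow> nat \<Rightarrow> nat \<Rightarrow> 'p option" where
  "inp M d \<sigma> arr t i =
     (if i = 0 then arr t
      else if i \<le> M \<and> 0 < d i \<and> d i \<le> t
        then inp M d \<sigma> arr (t - d i) (THE k. k \<le> M + 1 \<and> \<sigma> (t - d i) k = i)
      else None)"
  by pat_completeness auto
termination
  by (relation "measure (\<lambda>(M, d, \<sigma>, arr, t, i). t)") auto

definition outp :: "nat \<Rightarrow> (nat \<Rightarrow> nat) \<Rightarrow> (nat \<Rightarrow> nat \<Rightarrow> nat) \<Rightarrow> (nat \<Rightarrow> 'p option)
                 \<Rightarrow> nat \<Rightarrow> nat \<Rightarrow> 'p option" where
  "outp M d \<sigma> arr t op =
     (if \<exists>k \<le> M + 1. \<sigma> t k = op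
      then inp M d \<sigma> arr t (THE k. k \<le> M + 1 \<and> \<sigma> t k = op) else None)"

definition buffered :: "nat \<Rightarrow> (nat \<Rightarrow> nat) \<Rightarrow> (nat \<Rightarrow> nat \<Rightarrow> nat) \<Rightarrow> (nat \<Rightarrow> 'p option)
                 \<Rightarrow> nat \<Rightarrow> 'p set" where
  "buffered M d \<sigma> arr t =
     {p. \<exists>s \<le> t. \<exists>j \<in> {1..M}. outp M d \<sigma> arr s j = Some p \<and> t < s + d j}"

definition tag :: "'p::linorder set \<Rightarrow> 'p \<Rightarrow> nat" where
  "tag S p = card {x \<in> S. p \<le> x}"

definition ind :: "bool \<Rightarrow> nat" where
  "ind b = (if b then 1 else 0)"

definition admissible_arrivals :: "(nat \<Rightarrow> 'p option) \<Rightarrow> bool" where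
  "admissible_arrivals arr \<longleftrightarrow> arr 0 = None \<and>
     (\<forall>s t p. arr s = Some p \<and> arr t = Some p \<longrightarrow> s = t)"

definition pq_behaviour :: "nat \<Rightarrow> nat \<Rightarrow> (nat \<Rightarrow> nat) \<Rightarrow> (nat \<Rightarrow> nat \<Rightarrow> nat)
    \<Rightarrow> (nat \<Rightarrow> 'p::linorder option) \<Rightarrow> (nat \<Rightarrow> bool) \<Rightarrow> bool" where
  "pq_behaviour M B d \<sigma> arr c \<longleftrightarrow>
     (\<forall>t>0.
        let q = (\<lambda>s. card (buffered M d \<sigma> arr s));
            a = ind (arr t \<noteq> None);
            dep = outp M d \<sigma> arr t 0;
            los = outp M d \<sigma> arr t (M + 1);
            dd = ind (dep \<noteq> None);
            l = ind (los \<noteq> None);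
            S = buffered M d \<sigma> arr (t - 1) \<union> set_option (arr t)
        in q t + dd + l = q (t - 1) + a
         \<and> (dd = 1 \<longleftrightarrow> c t \<and> q (t - 1) + a > 0)
         \<and> (l = 1 \<longleftrightarrow> \<not> c t \<and> q (t - 1) = B \<and> a = 1)
         \<and> (\<forall>p. dep = Some p \<longrightarrow> tag S p = 1)
         \<and> (\<forall>p. los = Some p \<longrightarrow> tag S p = B + 1))"

definition optical_pq :: "nat \<Rightarrow> nat \<Rightarrow> (nat \<Rightarrow> nat)
    \<Rightarrow> (nat \<Rightarrow> (nat \<Rightarrow> 'p::linorder option) \<Rightarrow> (nat \<Rightarrow> bool) \<Rightarrow> nat \<Rightarrow> nat) \<Rightarrow> bool" where
  "optical_pq M B d pol \<longleftrightarrow>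
     (\<forall>i \<in> {1..M}. 0 < d i)
   \<and> (\<forall>t arr c. bij_betw (pol t arr c) {..M + 1} {..M + 1})
   \<and> (\<forall>t arr arr' c c'. (\<forall>s \<le> t. arr s = arr' s \<and> c s = c' s) \<longrightarrow>
         (\<forall>k \<le> M + 1. pol t arr c k = pol t arr' c' k))
   \<and> (\<forall>arr c. admissible_arrivals arr \<longrightarrow>
         pq_behaviour M B d (\<lambda>t. pol t arr c) arr c)"

end

theory Submission
  imports Defs
begin

text \<open>
  The contents of the buffer at each slot are forced by the specification, so only the routing has
  to be found. Call the smaller of a packet's distances to the two ends of a full queue its urgency.
  It changes by at most one per slot, a packet leaves the queue only with urgency 1, and at most
  \<open>2x\<close> packets have urgency below \<open>x\<close>. Hence a packet of urgency about \<open>2\<^sup>i\<close>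
  (level \<open>i\<close>) may be out of reach for a time of order \<open>2\<^sup>i\<close>.

  A packet travels in journeys. The \<open>n\<close>-th journey on a lane of level \<open>i\<close>, starting
  at slot \<open>s\<close>, first loses \<open>(n - s) mod 2\<^sup>i\<close> slots, one stage fiber of delay
  \<open>2\<^sup>j\<close> per binary digit, lowest digit first. Before stage \<open>j\<close> it is at a slot
  congruent to \<open>n\<close> modulo \<open>2\<^sup>j\<close>, which rules out collisions, and afterwards the traffic
  is equidistributed over the residues modulo \<open>2\<^sup>i\<close>. So there is always room for a last hop
  through a fiber whose delay is one of a constant number of multiples of \<open>2\<^sup>i\<close> such that
  only boundedly many packets of a level land in the same slot. On landing, the packet chooses its
  next level from its current urgency. A level needs \<open>O(i)\<close> fibers, so \<open>O(L\<^sup>2)\<close>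
  fibers support a buffer of \<open>2\<^sup>L\<close>.
\<close>

subsection \<open>The abstract priority queue\<close>

text \<open>For an empty \<open>S\<close> the value of \<open>Max S\<close> is unspecified, but
  \<open>S - {Max S}\<close> is empty either way.\<close>

primrec queue :: "nat \<Rightarrow> (nat \<Rightarrow> 'p::linorder option) \<Rightarrow> (nat \<Rightarrow> bool) \<Rightarrow> nat \<Rightarrow> 'p set" where
  "queue B arr c 0 = {}"
| "queue B arr c (Suc t) =
     (let S = queue B arr c t \<union> set_option (arr (Suc t)) in
      if c (Suc t) then S - {Max S} else if card S > B then S - {Min S} else S)"

text \<open>Rank 1 is served next and rank \<open>B + 1\<close> is the one that gets lost; both
  distances are offset so that urgency 1 means that the next slot may remove the packet. Being total
  in \<open>p\<close>, it satisfies the Lipschitz bounds below without a membership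
  hypothesis.\<close>

definition urgency :: "nat \<Rightarrow> 'p::linorder set \<Rightarrow> 'p \<Rightarrow> nat" where
  "urgency B S p = min (tag S p) (B + 1 - tag S p)"

lemma queue_cong:
  "(\<And>s. s \<le> t \<Longrightarrow> arr s = arr' s \<and> c s = c' s) \<Longrightarrow> queue B arr c t = queue B arr' c' t"
  by (induction t) (auto simp: Let_def)

lemma finite_queue [simp]: "finite (queue B arr c t)"
  by (induction t) (auto simp: Let_def)

lemma card_queue_le: "card (queue B arr c t) \<le> B"
proof (induction t)
  case (Suc t)
  let ?S = "queue B arr c t \<union> set_option (arr (Suc t))"
  have f: "finite ?S" by simp
  have le: "card ?S \<le> Suc B"
    using Suc.IH card_Un_le[of "queue B arr c t" "set_option (arr (Suc t))"]
    by (cases "arr (Suc t)") auto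
  show ?case
  proof (cases "?S = {}")
    case False
    have "Max ?S \<in> ?S" "Min ?S \<in> ?S" by (rule Max_in[OF f False], rule Min_in[OF f False])
    then have "card (?S - {Max ?S}) \<le> B" "card (?S - {Min ?S}) \<le> B"
      using le f by (simp_all add: card_Diff_singleton)
    then show ?thesis by (auto simp: Let_def)
  qed (auto simp: Let_def)
qed simp

lemma queue_Suc_subset:
  "queue B arr c (Suc t) \<subseteq> queue B arr c t \<union> set_option (arr (Suc t))"
  by (auto simp: Let_def split: if_splits)

declare queue.simps(2) [simp del]

lemma queue_arrived: "p \<in> queue B arr c t \<Longrightarrow> \<exists>s\<in>{0<..t}. arr s = Some p"
proof (induction t)
  case (Suc t)
  then consider "p \<in> queue B arr c t" | "arr (Suc t) = Some p"
    using queue_Suc_subset[of B arr c t] by auto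
  then show ?case
  proof cases
    case 1
    then obtain s where "s \<in> {0<..t}" "arr s = Some p" using Suc.IH by blast
    then show ?thesis by (intro bexI[of _ s]) simp_all
  qed (intro bexI[of _ "Suc t"], simp_all)
qed simp

lemma queue_arrived_after:
  assumes "p \<in> queue B arr c t" "p \<notin> queue B arr c x" "x \<le> t"
  shows "\<exists>s\<in>{x<..t}. arr s = Some p"
  using assms(3,1)
proof (induction t rule: dec_induct)
  case base
  then show ?case using assms(2) by simp
next
  case (step t)
  then consider "p \<in> queue B arr c t" | "arr (Suc t) = Some p"
    using queue_Suc_subset[of B arr c t] by auto
  then show ?case
  proof cases
    case 1
    then obtain s where "s \<in> {x<..t}" "arr s = Some p" using step.IH by blast
    then show ?thesis by (intro bexI[of _ s]) simp_all
  qed (use step.hyps in \<open>intro bexI[of _ "Suc t"], simp_all\<close>)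
qed

section \<open>Ranks and urgency of packets\<close>

lemma tag_bounds: "finite S \<Longrightarrow> p \<in> S \<Longrightarrow> 1 \<le> tag S p \<and> tag S p \<le> card S"
  unfolding tag_def using card_mono[of S "{x \<in> S. p \<le> x}"]
  by (auto simp: Suc_le_eq card_gt_0_iff)

lemma inj_on_tag: "finite S \<Longrightarrow> inj_on (tag S) S"
proof (rule linorder_inj_onI)
  fix x y assume *: "finite S" "x < y" "x \<in> S" "y \<in> S"
  then have "{z \<in> S. y \<le> z} \<subset> {z \<in> S. x \<le> z}" by force
  then show "tag S x \<noteq> tag S y"
    using psubset_card_mono[of "{z \<in> S. x \<le> z}" "{z \<in> S. y \<le> z}"] *(1)
    by (auto simp: tag_def)
qed (auto)

lemma tag_Max: "finite S \<Longrightarrow> S \<noteq> {} \<Longrightarrow> tag S (Max S) = 1"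
proof -
  assume "finite S" "S \<noteq> {}"
  then have "{x \<in> S. Max S \<le> x} = {Max S}" using Max_in by (auto intro: antisym Max_ge)
  then show ?thesis by (simp add: tag_def)
qed

lemma tag_Min: "finite S \<Longrightarrow> S \<noteq> {} \<Longrightarrow> tag S (Min S) = card S"
proof -
  assume "finite S" "S \<noteq> {}"
  then have "{x \<in> S. Min S \<le> x} = S" by auto
  then show ?thesis by (simp add: tag_def)
qed

text \<open>Ranks are distinct, and an urgency below \<open>x\<close> forces a rank in one of two
  intervals of length at most \<open>x\<close>, one at each end of a full queue.\<close>

lemma card_urgency_less:
  "card {p \<in> queue B arr c t. urgency B (queue B arr c t) p < x} \<le> 2 * x"
proof -
  let ?Q = "queue B arr c t"
  let ?A = "{p \<in> ?Q. urgency B ?Q p < x}"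
  have "card ?A = card (tag ?Q ` ?A)"
    by (rule card_image[symmetric]) (rule inj_on_subset[OF inj_on_tag], auto)
  also have "tag ?Q ` ?A \<subseteq> {..<x} \<union> {B + 1 - x ..< B + 1}"
  proof (rule image_subsetI)
    fix p assume "p \<in> ?A"
    then show "tag ?Q p \<in> {..<x} \<union> {B + 1 - x ..< B + 1}"
      using tag_bounds[OF finite_queue, of p B arr c t] card_queue_le[of B arr c t]
      by (simp add: urgency_def) linarith
  qed
  then have "card (tag ?Q ` ?A) \<le> card ({..<x} \<union> {B + 1 - x ..< B + 1})"
    by (intro card_mono) auto
  also have "\<dots> \<le> 2 * x"
    using card_Un_le[of "{..<x}" "{B + 1 - x ..< B + 1}"] by simp
  finally show ?thesis .
qed

text \<open>One slot adds at most the arrival to the set of packets ranked at or above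
  \<open>p\<close>, and takes at most one packet out of it.\<close>

lemma tag_queue_Suc:
  fixes arr :: "nat \<Rightarrow> 'p::linorder option"
  shows "tag (queue B arr c (Suc t)) p \<le> tag (queue B arr c t) p + 1"
    and "tag (queue B arr c t) p \<le> tag (queue B arr c (Suc t)) p + 1"
proof -
  let ?S = "queue B arr c t \<union> set_option (arr (Suc t))"
  let ?up = "\<lambda>S::'p set. {x \<in> S. p \<le> x}"
  have "?up (queue B arr c (Suc t)) \<subseteq> ?up (queue B arr c t) \<union> set_option (arr (Suc t))"
    using queue_Suc_subset[of B arr c t] by auto
  then have "card (?up (queue B arr c (Suc t))) \<le> card (?up (queue B arr c t) \<union> set_option (arr (Suc t)))"
    by (intro card_mono) auto
  also have "\<dots> \<le> card (?up (queue B arr c t)) + card (set_option (arr (Suc t)))"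
    by (rule card_Un_le)
  also have "card (set_option (arr (Suc t))) \<le> 1" by (cases "arr (Suc t)") auto
  finally show "tag (queue B arr c (Suc t)) p \<le> tag (queue B arr c t) p + 1"
    by (simp add: tag_def)
  define R where "R = (if c (Suc t) then {Max ?S} else {Min ?S})"
  have R: "card R \<le> 1" "finite R" by (simp_all add: R_def)
  have R': "queue B arr c t - R \<subseteq> queue B arr c (Suc t)"
    by (simp add: R_def queue.simps(2) Let_def) blast
  have "?up (queue B arr c t) \<subseteq> ?up (queue B arr c (Suc t)) \<union> R"
    using R' by blast
  then have "card (?up (queue B arr c t)) \<le> card (?up (queue B arr c (Suc t)) \<union> R)"
    using R by (intro card_mono) auto
  also have "\<dots> \<le> card (?up (queue B arr c (Suc t))) + card R" by (rule card_Un_le)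
  finally show "tag (queue B arr c t) p \<le> tag (queue B arr c (Suc t)) p + 1"
    using R(1) by (simp add: tag_def)
qed

lemma urgency_Suc:
  "urgency B (queue B arr c (Suc t)) p \<le> urgency B (queue B arr c t) p + 1"
  "urgency B (queue B arr c t) p \<le> urgency B (queue B arr c (Suc t)) p + 1"
proof -
  have *: "min a (B + 1 - a) \<le> min b (B + 1 - b) + 1" if "a \<le> b + 1" "b \<le> a + 1" for a b
  proof -
    have "B + 1 - a \<le> B + 1 - b + 1" using that(2) by simp
    then show ?thesis using that(1) by (simp add: min_def)
  qed
  show "urgency B (queue B arr c (Suc t)) p \<le> urgency B (queue B arr c t) p + 1"
    and "urgency B (queue B arr c t) p \<le> urgency B (queue B arr c (Suc t)) p + 1"
    unfolding urgency_def by (rule *; rule tag_queue_Suc)+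
qed

lemma urgency_lipschitz_add:
  "urgency B (queue B arr c (s + k)) p \<le> urgency B (queue B arr c s) p + k"
  "urgency B (queue B arr c s) p \<le> urgency B (queue B arr c (s + k)) p + k"
proof (induction k)
  case (Suc k)
  { case 1 show ?case using Suc(1) urgency_Suc(1)[of B arr c "s + k" p] by simp }
  { case 2 show ?case using Suc(2) urgency_Suc(2)[of B arr c "s + k" p] by simp }
qed simp_all

lemma urgency_lipschitz:
  assumes "s \<le> t"
  shows "urgency B (queue B arr c t) p \<le> urgency B (queue B arr c s) p + (t - s)"
    and "urgency B (queue B arr c s) p \<le> urgency B (queue B arr c t) p + (t - s)"
  using urgency_lipschitz_add[where k = "t - s" and s = s] assms by simp_all

text \<open>A departing packet has rank 1. A buffered packet is lost only as the minimum of more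
  than \<open>B\<close> packets, so the queue was full before and the packet had rank
  \<open>B\<close>, at distance 1 from the other end.\<close>

lemma urgency_removed:
  assumes "p \<in> queue B arr c t" "p \<notin> queue B arr c (Suc t)"
  shows "urgency B (queue B arr c t) p = 1"
proof -
  let ?Q = "queue B arr c t"
  let ?S = "?Q \<union> set_option (arr (Suc t))"
  have tb: "1 \<le> tag ?Q p" "tag ?Q p \<le> card ?Q" "card ?Q \<le> B"
    using tag_bounds[OF finite_queue assms(1)] card_queue_le[of B arr c t] by auto
  have ne: "?Q \<noteq> {}" using assms(1) by auto
  show ?thesis
  proof (cases "c (Suc t)")
    case True
    then have "p = Max ?S" using assms by (simp add: queue.simps(2) Let_def)
    then have "p = Max ?Q" using assms(1)
      by (intro Max_eqI[symmetric]) simp_all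
    then have "tag ?Q p = 1" using tag_Max[OF finite_queue ne] by simp
    then show ?thesis using tb by (simp add: urgency_def)
  next
    case False
    then have p: "p = Min ?S" and S: "card ?S > B"
      using assms False by (simp_all add: queue.simps(2) Let_def split: if_splits)
    from p have "p = Min ?Q" using assms(1)
      by (intro Min_eqI[symmetric]) simp_all
    then have "tag ?Q p = card ?Q" using tag_Min[OF finite_queue ne] by simp
    moreover have "card ?Q \<ge> B"
      using S card_Un_le[of ?Q "set_option (arr (Suc t))"] by (cases "arr (Suc t)") auto
    ultimately show ?thesis using tb by (simp add: urgency_def)
  qed
qed

text \<open>Removal requires urgency 1, and the Lipschitz bound keeps the urgency above 1 at every
  slot after which a removal could occur.\<close>

lemma queue_persists:
  assumes "p \<in> queue B arr c s" "s \<le> t" "t - s < urgency B (queue B arr c s) p"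
  shows "p \<in> queue B arr c t"
  using assms(2,3)
proof (induction t rule: dec_induct)
  case base
  then show ?case using assms(1) by simp
next
  case (step t)
  then have "p \<in> queue B arr c t" by simp
  moreover have "Suc (t - s) < urgency B (queue B arr c s) p"
    using step.prems step.hyps by (simp add: Suc_diff_le)
  then have "urgency B (queue B arr c t) p \<noteq> 1"
    using urgency_lipschitz(2)[of s t B arr c p] step.hyps by simp
  ultimately show ?case using urgency_removed by blast
qed

subsection \<open>Combinatorial tools\<close>

lemma card_spaced_le:
  fixes S :: "nat set"
  assumes "S \<subseteq> {a..<b}" "b \<le> a + m * u"
    and spaced: "\<And>s s'. s \<in> S \<Longrightarrow> s' \<in> S \<Longrightarrow> s < s' \<Longrightarrow> s + u \<le> s'"
  shows "card S \<le> m"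
proof (cases "u = 0")
  case True
  then show ?thesis using assms(1,2) by simp
next
  case False
  have "inj_on (\<lambda>s. (s - a) div u) S"
  proof (rule linorder_inj_onI)
    fix s s' assume *: "s < s'" "s \<in> S" "s' \<in> S"
    then have "(s - a) + u \<le> s' - a" using spaced[of s s'] assms(1) by force
    then have "((s - a) + u) div u \<le> (s' - a) div u" by (rule div_le_mono)
    then show "(s - a) div u \<noteq> (s' - a) div u" using False by simp
  qed auto
  moreover have "(\<lambda>s. (s - a) div u) ` S \<subseteq> {..<m}"
  proof (rule image_subsetI)
    fix s assume "s \<in> S"
    then have "s - a < m * u" using assms(1,2) by force
    then show "(s - a) div u \<in> {..<m}" using False by (simp add: less_mult_imp_div_less)
  qed
  ultimately show ?thesis using card_inj_on_le[of _ S "{..<m}"] by fastforce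
qed

lemma mod_eq_less_spaced:
  fixes u v v' :: nat
  assumes "v < v'" "v mod u = v' mod u" shows "v + u \<le> v'"
proof -
  have "u dvd v' - v" using assms mod_eq_dvd_iff_nat[of v v' u] by simp
  then have "u \<le> v' - v" using assms(1) by (simp add: dvd_imp_le)
  then show ?thesis using assms(1) by simp
qed

text \<open>Along \<open>A\<close> the counter increases by one per element, so a given counter
  residue is met only at every \<open>u\<close>-th element of \<open>A\<close>. This gives the
  equidistribution of the traffic of one lane over the residues.\<close>

lemma card_counter_residue_le:
  fixes A :: "nat set" and u :: nat
  assumes "X \<subseteq> A \<inter> {a..<b}" "0 < u"
    and res: "\<And>s. s \<in> X \<Longrightarrow> card (A \<inter> {..<s}) mod u = r"
  shows "card X \<le> card (A \<inter> {a..<b}) div u + 1"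
proof -
  let ?n = "\<lambda>s. card (A \<inter> {..<s})"
  let ?l = "card (A \<inter> {a..<b})"
  have mono: "?n s < ?n s'" if "s \<in> A" "s < s'" for s s'
    using that by (intro psubset_card_mono) auto
  have inj: "inj_on ?n X"
    by (rule linorder_inj_onI) (use mono assms(1) in \<open>fastforce+\<close>)
  have "?n ` X \<subseteq> {?n a ..< ?n a + ?l}"
  proof (rule image_subsetI)
    fix s assume s: "s \<in> X"
    then have sA: "s \<in> A" "a \<le> s" "s < b" using assms(1) by auto
    have "A \<inter> {..<s} = (A \<inter> {..<a}) \<union> (A \<inter> {a..<s})" using sA by auto
    moreover have "(A \<inter> {..<a}) \<inter> (A \<inter> {a..<s}) = {}" by auto
    ultimately have "?n s = ?n a + card (A \<inter> {a..<s})" by (simp add: card_Un_disjoint)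
    moreover have "card (A \<inter> {a..<s}) < ?l"
      using sA by (intro psubset_card_mono) auto
    ultimately show "?n s \<in> {?n a ..< ?n a + ?l}" by simp
  qed
  moreover have "?n a + ?l \<le> ?n a + (?l div u + 1) * u"
    using dividend_less_div_times[OF assms(2), of ?l] by simp
  moreover have "v + u \<le> v'" if "v \<in> ?n ` X" "v' \<in> ?n ` X" "v < v'" for v v'
    using that res by (intro mod_eq_less_spaced) auto
  ultimately have "card (?n ` X) \<le> ?l div u + 1" by (rule card_spaced_le)
  then show ?thesis using card_image[OF inj] by simp
qed

lemma greedy_representatives:
  assumes "finite A" "\<And>p. p \<in> A \<Longrightarrow> finite (S p) \<and> card A \<le> card (S p)"
  shows "\<exists>f. inj_on f A \<and> (\<forall>p\<in>A. f p \<in> S p)"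
  using assms
proof (induction A)
  case (insert a A)
  then have "\<And>p. p \<in> A \<Longrightarrow> finite (S p) \<and> card A \<le> card (S p)" by force
  then obtain f where f: "inj_on f A" "\<forall>p\<in>A. f p \<in> S p" using insert.IH by blast
  have "card (f ` A) < card (S a)"
    using card_image_le[OF insert.hyps(1), of f] insert.prems[of a] insert.hyps by simp
  then obtain z where "z \<in> S a" "z \<notin> f ` A"
    by (metis card_mono finite_imageI insert.hyps(1) leD subsetI)
  then show ?case
    using f insert.hyps by (intro exI[of _ "f(a := z)"]) (auto simp: inj_on_def)
qed simp

text \<open>Dependent choice with causality: the choice operator is applied to a predicate that sees
  the input \<open>w\<close> only up to slot \<open>t\<close>, so inputs that agree up to
  \<open>t\<close> receive equal values.\<close>

lemma causal_choice:
  fixes P :: "nat \<Rightarrow> (nat \<Rightarrow> 'w) \<Rightarrow> (nat \<Rightarrow> 's) \<Rightarrow> bool"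
  assumes cong: "\<And>t w w' f f'. (\<And>s. s \<le> t \<Longrightarrow> w s = w' s \<and> f s = f' s) \<Longrightarrow> P t w f \<Longrightarrow> P t w' f'"
    and ext: "\<And>t w f. (\<And>s. s < t \<Longrightarrow> P s w f) \<Longrightarrow> \<exists>x. P t w (f(t := x))"
  shows "\<exists>F. (\<forall>w w' t. (\<forall>s\<le>t. w s = w' s) \<longrightarrow> F w t = F w' t) \<and> (\<forall>w t. P t w (F w))"
proof -
  define nxt where "nxt w f t = f(t := (SOME x. P t w (f(t := x))))" for w f t
  \<comment> \<open>\<open>G w t\<close> is a history that is settled below \<open>t\<close>; its
    start value is arbitrary, since by \<open>cong\<close> no condition looks at later
    slots.\<close>
  define G where "G w t = rec_nat (\<lambda>_. undefined) (\<lambda>t f. nxt w f t) t" for w t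
  have G_Suc: "G w (Suc t) = nxt w (G w t) t" for w t by (simp add: G_def)
  define F where "F w t = G w (Suc t) t" for w t
  have stable: "G w t s = F w s" if "s < t" for w t s
    using that
  proof (induction t)
    case (Suc t)
    show ?case
    proof (cases "s = t")
      case False
      then have "G w (Suc t) s = G w t s" by (simp add: G_Suc nxt_def)
      then show ?thesis using Suc False by simp
    qed (simp add: F_def)
  qed simp
  have nxt_cong: "nxt w f t = nxt w' f t" if "\<And>s. s \<le> t \<Longrightarrow> w s = w' s" for w w' t f
  proof -
    have "P t w h = P t w' h" for h
      using cong[of t w w' h h] cong[of t w' w h h] that by auto
    then show ?thesis by (simp add: nxt_def)
  qed
  have G_cong: "G w t = G w' t" if "\<And>s. s < t \<Longrightarrow> w s = w' s" for w w' t
    using that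
  proof (induction t)
    case (Suc t)
    then have "G w t = G w' t" by simp
    then show ?case using Suc.prems nxt_cong[of t w w'] by (simp add: G_Suc)
  qed (simp add: G_def)
  have PF: "P t w (F w)" for t w
  proof (induction t rule: less_induct)
    case (less t)
    have "P s w (G w t)" if "s < t" for s
      by (rule cong[OF _ less[OF that]]) (use that stable[of _ t w] in auto)
    then have "\<exists>x. P t w ((G w t)(t := x))" by (rule ext)
    then have "P t w (nxt w (G w t) t)" unfolding nxt_def by (rule someI_ex)
    then have "P t w (G w (Suc t))" by (simp add: G_Suc)
    then show ?case by (rule cong[rotated]) (use stable[of _ "Suc t" w] in auto)
  qed
  show ?thesis
  proof (intro exI[of _ F] conjI allI impI)
    fix w w' :: "nat \<Rightarrow> 'w" and t assume "\<forall>s\<le>t. w s = w' s"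
    then show "F w t = F w' t" unfolding F_def using G_cong[of "Suc t" w w'] by simp
  qed (rule PF)
qed

subsection \<open>Journeys\<close>

text \<open>
  A journey of level \<open>i\<close> lasts less than \<open>8 * 2 ^ i\<close> slots; with the factor
  \<open>32 = 4 * 8\<close> the level then changes by at most one per journey.
\<close>

definition level_of :: "nat \<Rightarrow> nat" where
  "level_of r = (LEAST i. r < 32 * 2 ^ i)"

lemma less_level_of: "r < 32 * 2 ^ level_of r"
proof -
  have "r < 2 ^ r" by (rule less_exp)
  also have "(2::nat) ^ r \<le> 32 * 2 ^ r" by simp
  finally show ?thesis unfolding level_of_def by (rule LeastI)
qed

lemma level_of_le: "r < 32 * 2 ^ i \<Longrightarrow> level_of r \<le> i"
  unfolding level_of_def by (rule Least_le)

text \<open>Minimality: the next lower level was already too small. The bound is twice the limit on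
  the duration of a journey of that level.\<close>

lemma level_of_pos: "0 < level_of r \<Longrightarrow> 16 * 2 ^ level_of r \<le> r"
proof -
  assume "0 < level_of r"
  then obtain j where j: "level_of r = Suc j" using gr0_conv_Suc by blast
  then have "\<not> r < 32 * 2 ^ j" using level_of_le[of r j] by auto
  then show ?thesis by (simp add: j)
qed

text \<open>
  \<open>shift\<close> is the total delay in the stage fibers, the last hop takes \<open>turns * 2 ^ level\<close>
  slots, and \<open>stream\<close> tells apart the journeys of a level that land in the same slot.
\<close>

datatype journey = Journey (level: nat) (lane: nat) (shift: nat) (turns: nat) (stream: nat)

definition landing :: "nat \<Rightarrow> journey \<Rightarrow> nat" where
  "landing s x = s + shift x + turns x * 2 ^ level x"

definition lane_starts :: "(nat \<Rightarrow> 'p \<Rightarrow> journey option) \<Rightarrow> nat \<Rightarrow> nat \<Rightarrow> nat \<Rightarrow> nat set" where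
  "lane_starts J t i k = {s. s < t \<and> (\<exists>p x. J s p = Some x \<and> level x = i \<and> lane x = k)}"

definition at_switch :: "(nat \<Rightarrow> 'p option) \<Rightarrow> (nat \<Rightarrow> 'p \<Rightarrow> journey option) \<Rightarrow> nat \<Rightarrow> 'p \<Rightarrow> bool" where
  "at_switch arr J t p \<longleftrightarrow> arr t = Some p \<or> (\<exists>s<t. \<exists>x. J s p = Some x \<and> landing s x = t)"

text \<open>
  There are 1000 streams per level. A journey of level \<open>i\<close> starts on arrival or after landing
  on a stream of level \<open>i - 1\<close>, \<open>i\<close> or \<open>i + 1\<close>, whence
  \<open>3 * 1000 + 1\<close> lanes per level. The shift is \<open>(n - t) mod 2 ^ level\<close>, written without
  subtraction, where \<open>n\<close> counts the earlier starts on the lane. A landing slot can be found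
  because at most \<open>704 + 3001\<close> of the \<open>7 * 1000\<close> candidates are taken by earlier
  journeys and at most \<open>3001\<close> by simultaneous ones.
\<close>

definition schedule_step :: "nat \<Rightarrow> (nat \<Rightarrow> 'p::linorder option) \<Rightarrow> (nat \<Rightarrow> bool) \<Rightarrow>
    (nat \<Rightarrow> 'p \<Rightarrow> journey option) \<Rightarrow> nat \<Rightarrow> bool" where
  "schedule_step B arr c J t \<longleftrightarrow>
     (\<forall>p. J t p \<noteq> None \<longleftrightarrow> p \<in> queue B arr c t \<and> at_switch arr J t p) \<and>
     (\<forall>p x. J t p = Some x \<longrightarrow>
        level x = level_of (urgency B (queue B arr c t) p) \<and>
        lane x < 3001 \<and>
        shift x = (card (lane_starts J t (level x) (lane x)) + t * (2 ^ level x - 1)) mod 2 ^ level x \<and>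
        turns x \<in> (if level x = 0 then {1} else {1..7}) \<and>
        stream x < 1000) \<and>
     (\<forall>p x q y. J t p = Some x \<and> J t q = Some y \<and> level x = level y \<and> lane x = lane y \<longrightarrow> p = q) \<and>
     (\<forall>p x s q y. J t p = Some x \<and> s \<le> t \<and> J s q = Some y \<and> level x = level y \<and>
        stream x = stream y \<and> landing t x = landing s y \<longrightarrow> s = t \<and> p = q)"

lemma lane_starts_cong:
  "(\<And>s. s < t \<Longrightarrow> J s = J' s) \<Longrightarrow> lane_starts J t i k = lane_starts J' t i k"
  unfolding lane_starts_def by force

lemma at_switch_cong:
  "(\<And>s. s \<le> t \<Longrightarrow> arr s = arr' s \<and> J s = J' s) \<Longrightarrow> at_switch arr J t p = at_switch arr' J' t p"
  unfolding at_switch_def by force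

lemma schedule_step_cong:
  assumes "\<And>s. s \<le> t \<Longrightarrow> arr s = arr' s \<and> c s = c' s \<and> J s = J' s"
  shows "schedule_step B arr c J t = schedule_step B arr' c' J' t"
proof -
  have "queue B arr c t = queue B arr' c' t" by (rule queue_cong) (use assms in blast)
  moreover have "lane_starts J t = lane_starts J' t"
    by (intro ext lane_starts_cong) (use assms in auto)
  moreover have "at_switch arr J t = at_switch arr' J' t"
    by (intro ext at_switch_cong) (use assms in auto)
  moreover have "(\<forall>p x s q y. J t p = Some x \<and> s \<le> t \<and> J s q = Some y \<and> level x = level y \<and>
        stream x = stream y \<and> landing t x = landing s y \<longrightarrow> s = t \<and> p = q) \<longleftrightarrow>
     (\<forall>p x s q y. J' t p = Some x \<and> s \<le> t \<and> J' s q = Some y \<and> level x = level y \<and>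
        stream x = stream y \<and> landing t x = landing s y \<longrightarrow> s = t \<and> p = q)"
    by (simp add: assms cong: conj_cong)
  moreover have "J t = J' t" using assms by blast
  ultimately show ?thesis unfolding schedule_step_def by simp
qed

subsection \<open>Extending a schedule by one slot\<close>

text \<open>The schedule is fixed before slot \<open>T\<close> and is to be extended to slot \<open>T\<close>.\<close>

locale schedule =
  fixes B :: nat and arr :: "nat \<Rightarrow> 'p::linorder option" and c :: "nat \<Rightarrow> bool"
    and J :: "nat \<Rightarrow> 'p \<Rightarrow> journey option" and T :: nat
  assumes arr0: "arr 0 = None"
    and arr_inj: "\<And>s t p. s \<le> T \<Longrightarrow> t \<le> T \<Longrightarrow> arr s = Some p \<Longrightarrow> arr t = Some p \<Longrightarrow> s = t"
    and step: "\<And>s. s < T \<Longrightarrow> schedule_step B arr c J s"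
begin

abbreviation Q :: "nat \<Rightarrow> 'p set" where "Q \<equiv> queue B arr c"
abbreviation urg :: "nat \<Rightarrow> 'p \<Rightarrow> nat" where "urg t \<equiv> urgency B (Q t)"

lemma not_queue_before_arrival: "s < t \<Longrightarrow> t \<le> T \<Longrightarrow> arr t = Some p \<Longrightarrow> p \<notin> Q s"
proof
  assume "s < t" "t \<le> T" "arr t = Some p" "p \<in> Q s"
  moreover from this obtain a where "a \<in> {0<..s}" "arr a = Some p"
    using queue_arrived by blast
  ultimately show False using arr_inj[of a t p] by simp
qed

lemma start_iff: "s < T \<Longrightarrow> (\<exists>x. J s p = Some x) \<longleftrightarrow> p \<in> Q s \<and> at_switch arr J s p"
  using step[of s] unfolding schedule_step_def by blast

lemma start_queue: "s < T \<Longrightarrow> J s p = Some x \<Longrightarrow> p \<in> Q s"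
  using start_iff[of s p] by blast

lemma
  assumes "s < T" "J s p = Some x"
  shows start_level: "level x = level_of (urg s p)"
    and start_lane: "lane x < 3001"
    and start_shift: "shift x = (card (lane_starts J s (level x) (lane x)) + s * (2 ^ level x - 1)) mod 2 ^ level x"
    and start_turns: "turns x \<in> (if level x = 0 then {1} else {1..7})"
    and start_stream: "stream x < 1000"
  using step[OF assms(1)] assms(2) unfolding schedule_step_def by blast+

lemma lane_unique:
  "s < T \<Longrightarrow> J s p = Some x \<Longrightarrow> J s q = Some y \<Longrightarrow> level x = level y \<Longrightarrow> lane x = lane y \<Longrightarrow> p = q"
  using step[of s] unfolding schedule_step_def by blast

lemma landing_unique:
  assumes "s < T" "s' < T" "J s p = Some x" "J s' q = Some y" "level x = level y"
    "stream x = stream y" "landing s x = landing s' y"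
  shows "s = s' \<and> p = q"
proof -
  have *: "s = s' \<and> p = q" if "s' \<le> s" "s < T" "J s p = Some x" "J s' q = Some y" "level x = level y"
    "stream x = stream y" "landing s x = landing s' y" for s s' p q x y
    using step[of s] that unfolding schedule_step_def by blast
  show ?thesis
  proof (cases "s' \<le> s")
    case False
    then show ?thesis using *[of s s' q y p x] assms by simp
  qed (use *[of s' s] assms in blast)
qed

lemma shift_less: "s < T \<Longrightarrow> J s p = Some x \<Longrightarrow> shift x < 2 ^ level x"
  using start_shift[of s p x] by simp

text \<open>Modulo \<open>2 ^ level x\<close> the shift is the lane counter minus \<open>s\<close>,
  the factor \<open>2 ^ level x - 1\<close> acting as minus one; hence \<open>s\<close> plus the
  lowest \<open>j\<close> digits of the shift agrees with the counter modulo
  \<open>2 ^ j\<close>.\<close>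

lemma shift_mod:
  assumes "s < T" "J s p = Some x" "j \<le> level x"
  shows "(s + shift x mod 2 ^ j) mod 2 ^ j = card (lane_starts J s (level x) (lane x)) mod 2 ^ j"
proof -
  let ?n = "card (lane_starts J s (level x) (lane x))"
  have dvd: "(2::nat) ^ j dvd 2 ^ level x" using assms(3) by (rule le_imp_power_dvd)
  have "(s + shift x mod 2 ^ j) mod 2 ^ j = (s + (?n + s * (2 ^ level x - 1))) mod 2 ^ j"
    using start_shift[OF assms(1,2)] dvd by (simp add: mod_mod_cancel mod_add_right_eq)
  also have "s + (?n + s * (2 ^ level x - 1)) = ?n + s * 2 ^ level x"
  proof -
    have "s + s * (m - 1) = s * m" if "0 < m" for m using that by (cases m) simp_all
    from this[of "2 ^ level x"] show ?thesis by simp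
  qed
  also have "\<dots> mod 2 ^ j = (?n + s * 2 ^ level x mod 2 ^ j) mod 2 ^ j"
    by (rule mod_add_right_eq[symmetric])
  also have "s * 2 ^ level x mod 2 ^ j = 0" using dvd_mult[OF dvd] by (rule dvd_imp_mod_0)
  finally show ?thesis by simp
qed

text \<open>The shift is shorter than one turn, and there are 1 to 7 turns. At level 0 the landing
  must be in the very next slot, because such a packet may have urgency 1 and be removed at
  once.\<close>

lemma landing_bounds:
  assumes "s < T" "J s p = Some x"
  shows "s + 2 ^ level x \<le> landing s x" and "landing s x < s + 8 * 2 ^ level x"
    and "level x = 0 \<Longrightarrow> landing s x = s + 1"
proof -
  have t: "turns x \<in> (if level x = 0 then {1} else {1..7})" by (rule start_turns[OF assms])
  then have "1 \<le> turns x" "turns x \<le> 7" by (auto split: if_splits)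
  then have "1 * 2 ^ level x \<le> turns x * 2 ^ level x" "turns x * 2 ^ level x \<le> 7 * 2 ^ level x"
    by (simp_all only: mult_le_mono1)
  then show "s + 2 ^ level x \<le> landing s x" "landing s x < s + 8 * 2 ^ level x"
    using shift_less[OF assms] unfolding landing_def by linarith+
  show "landing s x = s + 1" if "level x = 0"
    using t shift_less[OF assms] that by (simp add: landing_def)
qed

lemma start_less_landing: "s < T \<Longrightarrow> J s p = Some x \<Longrightarrow> s < landing s x"
  using landing_bounds(1)[of s p x] less_le_trans[of s "s + 2 ^ level x" "landing s x"] by simp

text \<open>Above level 0 the urgency at the start is at least \<open>16 * 2 ^ level x\<close>,
  while the journey takes less than half as many slots. At level 0 only the starting slot is
  concerned. So no packet is removed while it is out of reach.\<close>

lemma in_queue_until_landing: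
  assumes "s < T" "J s p = Some x" "s \<le> t" "t < landing s x"
  shows "p \<in> Q t"
proof (cases "level x = 0")
  case True
  then show ?thesis
    using assms start_queue[OF assms(1,2)] landing_bounds(3)[OF assms(1,2)] by (simp add: le_less_Suc_eq)
next
  case False
  then have "16 * 2 ^ level x \<le> urg s p"
    using start_level[OF assms(1,2)] level_of_pos[of "urg s p"] by simp
  then show ?thesis
    using assms landing_bounds(2)[OF assms(1,2)]
    by (intro queue_persists[OF start_queue[OF assms(1,2)]]) linarith+
qed

text \<open>A packet starting at \<open>t\<close> cannot have arrived then, since it was queued at
  \<open>s\<close>; so some journey lands at \<open>t\<close>. Induction on \<open>t\<close>
  compares that journey with the given one and excludes that it started before
  \<open>s\<close>.\<close>

lemma journeys_disjoint:
  assumes "s < t" "t < T" "J s p = Some x" "J t p = Some y"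
  shows "landing s x \<le> t"
  using assms
proof (induction t arbitrary: s x y rule: less_induct)
  case (less t)
  have "at_switch arr J t p" using start_iff[of t p] less.prems by blast
  moreover have "arr t \<noteq> Some p"
    using not_queue_before_arrival[of s t p] start_queue[of s p x] less.prems by auto
  ultimately obtain s' z where s': "s' < t" "J s' p = Some z" "landing s' z = t"
    unfolding at_switch_def by blast
  consider "s < s'" | "s' < s" | "s = s'" by linarith
  then show ?case
  proof cases
    case 1
    then have "landing s x \<le> s'" using less.IH[of s' s x z] s' less.prems by simp
    then show ?thesis using s' by simp
  next
    case 2
    then have "landing s' z \<le> s" using less.IH[of s s' z x] less.prems s' by simp
    then show ?thesis using s' less.prems by simp
  qed (use s' less.prems in auto)
qed

section \<open>Counting the landing slots that are taken\<close>

lemma queue_earlier_urgent: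
  assumes "p \<in> Q s" "urg s p < a" "t \<le> s" "s \<le> T" "s - t \<le> b"
  shows "p \<in> {q \<in> Q t. urg t q < a + b} \<union> {q. \<exists>x\<in>{t<..s}. arr x = Some q}"
proof (cases "p \<in> Q t")
  case True
  then show ?thesis using urgency_lipschitz(2)[OF assms(3), of B arr c p] assms(2,5) by simp
next
  case False
  then show ?thesis using queue_arrived_after[OF assms(1) False assms(3)] by blast
qed

text \<open>The window has the maximal length of a journey of level \<open>i\<close>, so it contains
  the starts of all journeys of that level still under way at \<open>T\<close>.\<close>

definition recent_starts :: "nat \<Rightarrow> (nat \<times> 'p) set" where
  "recent_starts i = {(s, p). T - 8 * 2 ^ i \<le> s \<and> s < T \<and> (\<exists>x. J s p = Some x \<and> level x = i)}"

text \<open>With \<open>u = 2 ^ i\<close>: a packet has urgency below \<open>32 * u\<close> when it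
  starts on level \<open>i\<close>, hence below \<open>40 * u\<close> at the beginning of the window
  unless it arrived later. This allows \<open>2 * 40 * u + 8 * u\<close> packets, each with at most
  8 starts since journeys last at least \<open>u\<close> slots; the product is
  \<open>704 * u\<close>.\<close>

lemma card_recent_starts: "finite (recent_starts i) \<and> card (recent_starts i) \<le> 704 * 2 ^ i"
proof -
  let ?Y = "recent_starts i"
  define u :: nat where "u = 2 ^ i"
  define t where "t = T - 8 * u"
  define P where "P = {q \<in> Q t. urg t q < 40 * u} \<union> (\<Union>x\<in>{t<..<T}. set_option (arr x))"
  define S where "S p = {s\<in>{t..<T}. \<exists>x. J s p = Some x \<and> level x = i}" for p
  have tT: "t \<le> T" "T \<le> t + 8 * u" by (auto simp: t_def)
  have cardS: "card (S p) \<le> 8" for p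
  proof (rule card_spaced_le[where u = u])
    show "S p \<subseteq> {t..<T}" "T \<le> t + 8 * u" using tT by (auto simp: S_def)
    fix s s' assume "s \<in> S p" "s' \<in> S p" "s < s'"
    then obtain x y where "s < T" "s' < T" "J s p = Some x" "level x = i" "J s' p = Some y"
      by (auto simp: S_def)
    then show "s + u \<le> s'"
      using landing_bounds(1)[of s p x] journeys_disjoint[of s s' p x y] \<open>s < s'\<close>
      by (simp add: u_def)
  qed
  have finS: "finite (S p)" for p by (simp add: S_def)
  have sub: "?Y \<subseteq> (\<Union>p\<in>P. S p \<times> {p})"
  proof
    fix z assume "z \<in> ?Y"
    then obtain s p x where z: "z = (s, p)" and s: "t \<le> s" "s < T" and x: "J s p = Some x" "level x = i"
      by (auto simp: recent_starts_def t_def u_def)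
    have "urg s p < 32 * u"
      using start_level[OF s(2) x(1)] less_level_of[of "urg s p"] x(2) by (simp add: u_def)
    then have "p \<in> {q \<in> Q t. urg t q < 32 * u + 8 * u} \<union> {q. \<exists>x\<in>{t<..s}. arr x = Some q}"
      using start_queue[OF s(2) x(1)] s tT by (intro queue_earlier_urgent) simp_all
    then have "p \<in> P"
      using s by (force simp: P_def)
    then show "z \<in> (\<Union>p\<in>P. S p \<times> {p})"
      using z s x by (auto simp: S_def)
  qed
  have finP: "finite P" by (auto simp: P_def)
  have "card (\<Union>x\<in>{t<..<T}. set_option (arr x)) \<le> (\<Sum>x\<in>{t<..<T}. card (set_option (arr x)))"
    by (intro card_UN_le) simp
  also have "\<dots> \<le> (\<Sum>x\<in>{t<..<T}. 1)"
  proof (rule sum_mono)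
    show "card (set_option (arr x)) \<le> 1" for x by (cases "arr x") simp_all
  qed
  also have "\<dots> \<le> 8 * u" using tT by simp
  finally have "card P \<le> 2 * (40 * u) + 8 * u"
    unfolding P_def by (intro order_trans[OF card_Un_le] add_mono card_urgency_less)
  then have P: "card P * 8 \<le> 704 * u" by simp
  have fin: "finite (\<Union>p\<in>P. S p \<times> {p})" using finP finS by blast
  have "card ?Y \<le> card (\<Union>p\<in>P. S p \<times> {p})" by (rule card_mono[OF fin sub])
  also have "\<dots> \<le> (\<Sum>p\<in>P. card (S p \<times> {p}))" by (intro card_UN_le finP)
  also have "\<dots> \<le> (\<Sum>p\<in>P. 8)"
    by (intro sum_mono) (use cardS in \<open>simp add: card_cartesian_product\<close>)
  also have "\<dots> \<le> 704 * u" using P by simp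
  finally show ?thesis using finite_subset[OF sub fin] by (simp add: u_def)
qed

definition pending :: "nat \<Rightarrow> nat \<Rightarrow> (nat \<times> 'p) set" where
  "pending i r = {(s, p). s < T \<and> (\<exists>x. J s p = Some x \<and> level x = i \<and> T < landing s x \<and>
     landing s x mod 2 ^ i = r)}"

text \<open>The last hop is a multiple of \<open>2 ^ i\<close>, so the residue of the landing slot
  is that of the lane counter at the start. A lane therefore contributes at most the fraction
  \<open>1 / 2 ^ i\<close> of its recent starts, plus one for rounding; over 3001 lanes this makes
  at most \<open>704 + 3001\<close>.\<close>

lemma card_pending_le: "finite (pending i r) \<and> card (pending i r) \<le> 3705"
proof -
  define X where "X = pending i r"
  define u :: nat where "u = 2 ^ i"
  define t where "t = T - 8 * u"
  define Y where "Y = recent_starts i"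
  define Yk where "Yk k = {(s, p). t \<le> s \<and> s < T \<and> (\<exists>x. J s p = Some x \<and> level x = i \<and> lane x = k)}" for k
  define Xk where "Xk k = X \<inter> Yk k" for k
  have Y: "finite Y" "card Y \<le> 704 * u"
    using card_recent_starts[of i] by (simp_all add: Y_def u_def)
  have YkY: "Yk k \<subseteq> Y" for k by (auto simp: Yk_def Y_def recent_starts_def t_def u_def)
  have finYk: "finite (Yk k)" for k using finite_subset[OF YkY Y(1)] .
  have XY: "X \<subseteq> (\<Union>k<3001. Xk k)"
  proof
    fix z assume z: "z \<in> X"
    then obtain s p x where zz: "z = (s, p)" "s < T" and x: "J s p = Some x" "level x = i" "T < landing s x"
      by (auto simp: X_def pending_def)
    have "t \<le> s" using landing_bounds(2)[OF zz(2) x(1)] x by (simp add: t_def u_def)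
    then have "z \<in> Yk (lane x)" using zz x by (auto simp: Yk_def)
    then show "z \<in> (\<Union>k<3001. Xk k)" using start_lane[OF zz(2) x(1)] z by (auto simp: Xk_def)
  qed
  have u0: "0 < u" by (simp add: u_def)
  have lane_bound: "u * card (Xk k) \<le> card (Yk k) + u" for k
  proof -
    let ?A = "lane_starts J T i k"
    have "inj_on fst (Yk k)"
      using lane_unique by (force simp: inj_on_def Yk_def)
    then have inj: "inj_on fst (Xk k)" by (rule inj_on_subset) (auto simp: Xk_def)
    have fst: "fst ` Xk k \<subseteq> ?A \<inter> {t..<T}"
      by (auto simp: Xk_def Yk_def lane_starts_def) blast
    have "card (?A \<inter> {..<s}) mod u = r" if "s \<in> fst ` Xk k" for s
    proof -
      obtain p x where x: "s < T" "J s p = Some x" "level x = i" "lane x = k" "landing s x mod u = r"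
        using \<open>s \<in> fst ` Xk k\<close> by (auto simp: Xk_def Yk_def X_def pending_def u_def)
      have "?A \<inter> {..<s} = lane_starts J s i k" using x(1) by (auto simp: lane_starts_def)
      moreover have "landing s x mod u = (s + shift x) mod u" by (simp add: landing_def x(3) u_def)
      moreover have "(s + shift x) mod u = card (lane_starts J s i k) mod u"
        using shift_mod[OF x(1,2) order_refl] shift_less[OF x(1,2)] x(3,4) by (simp add: u_def)
      ultimately show ?thesis using x(5) by simp
    qed
    then have "card (fst ` Xk k) \<le> card (?A \<inter> {t..<T}) div u + 1"
      by (rule card_counter_residue_le[OF fst u0])
    then have "u * card (Xk k) \<le> u * (card (?A \<inter> {t..<T}) div u + 1)"
      unfolding card_image[OF inj] by (rule mult_le_mono2)
    also have "\<dots> \<le> card (?A \<inter> {t..<T}) + u"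
      by (simp only: distrib_left mult_1_right add_le_mono1 times_div_less_eq_dividend)
    also have "?A \<inter> {t..<T} = fst ` Yk k"
      by (force simp: lane_starts_def Yk_def)
    also have "card (fst ` Yk k) \<le> card (Yk k)" using finYk by (rule card_image_le)
    finally show ?thesis by simp
  qed
  have finU: "finite (\<Union>k<3001. Xk k)" using finYk by (auto simp: Xk_def)
  have "u * card X \<le> u * card (\<Union>k<3001. Xk k)" using card_mono[OF finU XY] by simp
  also have "\<dots> \<le> u * (\<Sum>k<3001. card (Xk k))" by (intro mult_le_mono2 card_UN_le) simp
  also have "\<dots> \<le> (\<Sum>k<3001. card (Yk k) + u)" unfolding sum_distrib_left by (intro sum_mono lane_bound)
  also have "\<dots> = card (\<Union>k<3001. Yk k) + 3001 * u"
    by (subst card_UN_disjoint) (use finYk in \<open>auto simp: Yk_def sum.distrib\<close>)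
  also have "card (\<Union>k<3001. Yk k) \<le> card Y" by (intro card_mono Y(1)) (use YkY in blast)
  also have "card Y + 3001 * u \<le> u * 3705" using Y(2) by simp
  finally have "card X \<le> 3705" using u0 by simp
  then show ?thesis using finite_subset[OF XY finU] by (simp add: X_def)
qed

text \<open>The urgency moves by less than \<open>8 * 2 ^ level x\<close>. From below
  \<open>32 * 2 ^ level x\<close> it stays below the double of that, and from at least
  \<open>16 * 2 ^ level x\<close> it stays above \<open>8 * 2 ^ level x\<close>, which excludes a
  drop by two levels.\<close>

lemma level_adjacent:
  assumes "s < T" "J s p = Some x" "landing s x = T"
  shows "level x \<in> {level_of (urg T p) - 1 .. level_of (urg T p) + 1}"
proof -
  let ?l = "level x" and ?i = "level_of (urg T p)"
  have lv: "?l = level_of (urg s p)" by (rule start_level[OF assms(1,2)])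
  have d: "T - s < 8 * 2 ^ ?l" using landing_bounds(2)[OF assms(1,2)] assms(1,3) by linarith
  have "urg T p < 32 * 2 ^ Suc ?l"
    using urgency_lipschitz(1)[of s T B arr c p] assms(1) d less_level_of[of "urg s p"]
    unfolding lv by simp
  then have "?i \<le> Suc ?l" by (rule level_of_le)
  moreover have "?l \<le> ?i + 1"
  proof (rule ccontr)
    assume "\<not> ?l \<le> ?i + 1"
    then have "2 + ?i \<le> ?l" "0 < ?l" by auto
    then have "(2::nat) ^ (2 + ?i) \<le> 2 ^ ?l" by (intro power_increasing) simp_all
    moreover have "16 * 2 ^ ?l \<le> urg s p" using level_of_pos \<open>0 < ?l\<close> unfolding lv by blast
    moreover have "urg s p \<le> urg T p + (T - s)"
      using assms(1) by (intro urgency_lipschitz(2)) simp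
    ultimately show False using d less_level_of[of "urg T p"] by simp
  qed
  ultimately show ?thesis by simp
qed

section \<open>Routing the packets that are at the switch in slot \<open>T\<close>\<close>

definition ready :: "nat \<Rightarrow> 'p set" where
  "ready i = {p \<in> Q T. at_switch arr J T p \<and> level_of (urg T p) = i}"

lemma finite_ready: "finite (ready i)"
  by (simp add: ready_def)

text \<open>A ready packet is the arrival or has just landed, and then level and stream of the
  landing journey identify it. Three levels with 1000 streams each, and the arrival, make
  3001.\<close>

lemma card_ready_le: "card (ready i) \<le> 3001"
proof -
  define g where "g p = (if arr T = Some p then None else
      Some (SOME (l, h). \<exists>s<T. \<exists>x. J s p = Some x \<and> landing s x = T \<and> level x = l \<and> stream x = h))" for p
  have g: "\<exists>s<T. \<exists>x. J s p = Some x \<and> landing s x = T \<and> level x = l \<and> stream x = h"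
    if "p \<in> ready i" "g p = Some (l, h)" for p l h
  proof -
    have "at_switch arr J T p" "arr T \<noteq> Some p"
      using that by (auto simp: ready_def g_def split: if_splits)
    then have "\<exists>lh. case lh of (l, h) \<Rightarrow> \<exists>s<T. \<exists>x. J s p = Some x \<and> landing s x = T \<and> level x = l \<and> stream x = h"
      unfolding at_switch_def by blast
    from someI_ex[OF this] show ?thesis using that(2) \<open>arr T \<noteq> Some p\<close> by (simp add: g_def)
  qed
  have "inj_on g (ready i)"
  proof (rule inj_onI)
    fix p q assume pq: "p \<in> ready i" "q \<in> ready i" "g p = g q"
    show "p = q"
    proof (cases "g p")
      case None
      then show ?thesis using pq(3) by (auto simp: g_def split: if_splits)
    next
      case (Some lh)
      obtain l h where lh: "lh = (l, h)" by (cases lh)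
      obtain s x s' y where "s < T" "J s p = Some x" "landing s x = T" "level x = l" "stream x = h"
        "s' < T" "J s' q = Some y" "landing s' y = T" "level y = l" "stream y = h"
        using g[OF pq(1), of l h] g[OF pq(2), of l h] Some pq(3) lh by auto
      then show ?thesis using landing_unique[of s s' p x q y] by simp
    qed
  qed
  moreover have "g ` ready i \<subseteq> insert None (Some ` ({i - 1..i + 1} \<times> {..<1000}))"
  proof (rule image_subsetI)
    fix p assume p: "p \<in> ready i"
    show "g p \<in> insert None (Some ` ({i - 1..i + 1} \<times> {..<1000}))"
    proof (cases "g p")
      case (Some lh)
      obtain l h where lh: "lh = (l, h)" by (cases lh)
      obtain s x where x: "s < T" "J s p = Some x" "landing s x = T" "level x = l" "stream x = h"
        using g[OF p, of l h] Some lh by auto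
      have "l \<in> {i - 1..i + 1}" using level_adjacent[OF x(1-3)] x(4) p by (simp add: ready_def)
      moreover have "h < 1000" using start_stream[OF x(1,2)] x(5) by simp
      ultimately show ?thesis using Some lh by simp
    qed simp
  qed
  ultimately have "card (ready i) \<le> card (insert None (Some ` ({i - 1..i + 1} \<times> {..<1000::nat})))"
    by (intro card_inj_on_le) simp_all
  also have "\<dots> \<le> Suc (card ({i - 1..i + 1} \<times> {..<1000::nat}))"
    using card_insert_le_m1 card_image_le by (simp add: card_image card_insert_if)
  also have "\<dots> \<le> 3001" by (simp add: card_cartesian_product)
  finally show ?thesis .
qed

text \<open>Level 0 has a single turn count, hence only 1000 candidates, for which the bound 3001 is
  too weak; the urgency bound gives 64 packets.\<close>

lemma card_ready_0_le: "card (ready 0) \<le> 1000"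
proof -
  have "ready 0 \<subseteq> {p \<in> Q T. urg T p < 32}"
  proof
    fix p assume "p \<in> ready 0"
    then show "p \<in> {p \<in> Q T. urg T p < 32}"
      using less_level_of[of "urg T p"] by (simp add: ready_def)
  qed
  then have "card (ready 0) \<le> card {p \<in> Q T. urg T p < 32}" by (intro card_mono) simp_all
  also have "\<dots> \<le> 2 * 32" by (rule card_urgency_less)
  finally show ?thesis by simp
qed

definition lane_shift :: "nat \<Rightarrow> nat \<Rightarrow> nat" where
  "lane_shift i k = (card (lane_starts J T i k) + T * (2 ^ i - 1)) mod 2 ^ i"

definition free_slots :: "nat \<Rightarrow> nat \<Rightarrow> (nat \<times> nat) set" where
  "free_slots i k = {(m, h). m \<in> (if i = 0 then {1} else {1..7}) \<and> h < 1000 \<and>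
     (\<forall>s<T. \<forall>p x. J s p = Some x \<longrightarrow> level x = i \<longrightarrow> stream x = h \<longrightarrow>
        landing s x \<noteq> T + lane_shift i k + m * 2 ^ i)}"

lemma finite_free_slots: "finite (free_slots i k)"
proof (rule finite_subset)
  show "free_slots i k \<subseteq> {..7} \<times> {..<1000}" by (auto simp: free_slots_def split: if_splits)
qed simp

text \<open>For a given lane all candidates lie in one residue class modulo \<open>2 ^ i\<close>, so
  only journeys in \<open>pending\<close> for that class can block them: \<open>7000 - 3705\<close>
  still exceeds 3001. At level 0 every earlier journey has landed by \<open>T\<close>, so all 1000
  candidates are free.\<close>

lemma card_free_slots_ge: "card (ready i) \<le> card (free_slots i k)"
proof (cases "i = 0")
  case True
  have "{1} \<times> {..<1000} \<subseteq> free_slots i k"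
  proof -
    have "landing s x \<noteq> T + 1" if "s < T" "J s p = Some x" "level x = 0" for s p x
      using landing_bounds(3)[OF that(1,2,3)] that(1) by simp
    then show ?thesis using True by (auto simp: free_slots_def lane_shift_def)
  qed
  from card_mono[OF finite_free_slots this] show ?thesis
    using card_ready_0_le True by (simp add: card_cartesian_product)
next
  case False
  define y where "y = T + lane_shift i k"
  \<comment> \<open>A pending journey is sent to the pair of turns and stream that it
    blocks.\<close>
  define g where "g z = (case z of (s, p) \<Rightarrow> let x = the (J s p) in ((landing s x - y) div 2 ^ i, stream x))" for z
  let ?X = "pending i (y mod 2 ^ i)"
  have sub: "{1..7} \<times> {..<1000} - free_slots i k \<subseteq> g ` ?X"
  proof
    fix z assume z: "z \<in> {1..7} \<times> {..<1000} - free_slots i k"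
    obtain m h where mh: "z = (m, h)" by (cases z)
    have m: "0 < m" using z mh by auto
    obtain s p x where x: "s < T" "J s p = Some x" "level x = i" "stream x = h"
      and l: "landing s x = y + m * 2 ^ i"
      using z mh False by (auto simp: free_slots_def y_def)
    have "T < landing s x" using m unfolding l y_def by (simp add: add.assoc)
    then have "(s, p) \<in> ?X" using x l by (simp add: pending_def)
    moreover have "g (s, p) = z" using x l mh by (simp add: g_def)
    ultimately show "z \<in> g ` ?X" by force
  qed
  have X: "finite ?X" "card ?X \<le> 3705" using card_pending_le by auto
  have "card ({1..7} \<times> {..<1000::nat} - free_slots i k) \<le> card (g ` ?X)"
    using X(1) sub by (intro card_mono) auto
  also have "\<dots> \<le> 3705" using card_image_le[OF X(1), of g] X(2) by simp
  finally have "card ({1..7} \<times> {..<1000::nat} - free_slots i k) \<le> 3705" .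
  moreover have "card ({1..7::nat} \<times> {..<1000::nat}) - card (free_slots i k)
      \<le> card ({1..7} \<times> {..<1000::nat} - free_slots i k)"
    by (rule diff_card_le_card_Diff[OF finite_free_slots])
  ultimately show ?thesis using card_ready_le[of i] by (simp add: card_cartesian_product)
qed

lemma ex_lanes: "\<exists>f. inj_on f (ready i) \<and> (\<forall>p\<in>ready i. f p < (3001::nat))"
proof -
  have "\<exists>f. f ` ready i \<subseteq> {..<3001::nat} \<and> inj_on f (ready i)"
    using card_ready_le finite_ready by (intro card_le_inj) simp_all
  then show ?thesis by (auto simp: subset_eq)
qed

text \<open>Packets on different lanes may have different shifts, so it is the landing slots with
  streams that must be distinct, not the turns with streams; the greedy choice is made among the
  former and then pulled back.\<close>

lemma ex_slots:
  "\<exists>f. inj_on (\<lambda>p. (T + lane_shift i (kk p) + fst (f p) * 2 ^ i, snd (f p))) (ready i) \<and>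
     (\<forall>p\<in>ready i. f p \<in> free_slots i (kk p))"
proof -
  let ?h = "\<lambda>p (m, h). (T + lane_shift i (kk p) + m * 2 ^ i, h)"
  have inj: "inj_on (?h p) (free_slots i (kk p))" for p
    by (auto simp: inj_on_def)
  have "\<exists>f. inj_on f (ready i) \<and> (\<forall>p\<in>ready i. f p \<in> ?h p ` free_slots i (kk p))"
    by (rule greedy_representatives[OF finite_ready])
      (use finite_free_slots card_free_slots_ge in \<open>simp add: card_image[OF inj]\<close>)
  then obtain f where f: "inj_on f (ready i)" "\<forall>p\<in>ready i. f p \<in> ?h p ` free_slots i (kk p)"
    by blast
  have "\<forall>p\<in>ready i. \<exists>z. z \<in> free_slots i (kk p) \<and> f p = ?h p z" using f(2) by blast
  then obtain g where g: "\<forall>p\<in>ready i. g p \<in> free_slots i (kk p) \<and> f p = ?h p (g p)"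
    using bchoice by metis
  have "inj_on (\<lambda>p. (T + lane_shift i (kk p) + fst (g p) * 2 ^ i, snd (g p))) (ready i)"
    using f(1) by (rule inj_on_cong[THEN iffD1, rotated]) (use g in \<open>auto simp: case_prod_beta\<close>)
  then show ?thesis using g by blast
qed

text \<open>Levels are independent, since both uniqueness conditions concern journeys of equal
  level. Lanes come first: a lane fixes the shift, on which the candidate landing slots
  depend.\<close>

lemma ex_schedule_step: "\<exists>g. schedule_step B arr c (J(T := g)) T"
proof -
  define lev where "lev p = level_of (urg T p)" for p
  have "\<forall>i. \<exists>f. inj_on f (ready i) \<and> (\<forall>p\<in>ready i. f p < (3001::nat))"
    using ex_lanes by blast
  from choice[OF this] obtain kk
    where "\<forall>i. inj_on (kk i) (ready i) \<and> (\<forall>p\<in>ready i. kk i p < (3001::nat))" ..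
  then have kk: "inj_on (kk i) (ready i)" "p \<in> ready i \<Longrightarrow> kk i p < 3001" for i p
    by blast+
  define slot_of where "slot_of i f p = (T + lane_shift i (kk i p) + fst (f p) * 2 ^ i, snd (f p))"
    for i p and f :: "'p \<Rightarrow> nat \<times> nat"
  have "\<forall>i. \<exists>f. inj_on (slot_of i f) (ready i) \<and> (\<forall>p\<in>ready i. f p \<in> free_slots i (kk i p))"
  proof
    show "\<exists>f. inj_on (slot_of i f) (ready i) \<and> (\<forall>p\<in>ready i. f p \<in> free_slots i (kk i p))" for i
      unfolding slot_of_def using ex_slots[of i "kk i"] .
  qed
  from choice[OF this] obtain sl
    where "\<forall>i. inj_on (slot_of i (sl i)) (ready i) \<and> (\<forall>p\<in>ready i. sl i p \<in> free_slots i (kk i p))" ..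
  then have sl: "inj_on (slot_of i (sl i)) (ready i)"
    "p \<in> ready i \<Longrightarrow> sl i p \<in> free_slots i (kk i p)" for i p
    by blast+
  define mk where "mk p = (let i = lev p in
      Journey i (kk i p) (lane_shift i (kk i p)) (fst (sl i p)) (snd (sl i p)))" for p
  define g where "g p = (if p \<in> ready (lev p) then Some (mk p) else None)" for p
  let ?J = "J(T := g)"
  have ready: "p \<in> ready (lev p) \<longleftrightarrow> p \<in> Q T \<and> at_switch arr J T p" for p
    by (simp add: ready_def lev_def)
  have gD: "p \<in> ready (lev p)" "x = mk p" if "g p = Some x" for p x
    using that by (auto simp: g_def split: if_splits)
  have slot: "fst (sl i p) \<in> (if i = 0 then {1} else {1..7})" "snd (sl i p) < 1000"
    "\<And>s q x. s < T \<Longrightarrow> J s q = Some x \<Longrightarrow> level x = i \<Longrightarrow> stream x = snd (sl i p) \<Longrightarrow>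
        landing s x \<noteq> T + lane_shift i (kk i p) + fst (sl i p) * 2 ^ i" if "p \<in> ready i" for p i
    using sl(2)[OF that] by (auto simp: free_slots_def case_prod_beta)
  \<comment> \<open>Both \<open>at_switch\<close> and \<open>lane_starts\<close> consult the
    journeys before \<open>T\<close> only, so the update does not affect them.\<close>
  have at: "at_switch arr ?J T p = at_switch arr J T p" for p
  proof -
    have "(\<exists>s<T. \<exists>x. ?J s p = Some x \<and> landing s x = T) \<longleftrightarrow> (\<exists>s<T. \<exists>x. J s p = Some x \<and> landing s x = T)"
      by (rule ex_cong1) (simp cong: conj_cong)
    then show ?thesis unfolding at_switch_def by (rule arg_cong)
  qed
  have ls: "lane_starts ?J T i k = lane_starts J T i k" for i k
    by (rule lane_starts_cong) simp
  have "g p \<noteq> None \<longleftrightarrow> p \<in> Q T \<and> at_switch arr ?J T p" for p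
    unfolding at using ready[of p] by (simp add: g_def)
  moreover have "level x = level_of (urg T p) \<and> lane x < 3001 \<and>
        shift x = (card (lane_starts ?J T (level x) (lane x)) + T * (2 ^ level x - 1)) mod 2 ^ level x \<and>
        turns x \<in> (if level x = 0 then {1} else {1..7}) \<and> stream x < 1000" if "g p = Some x" for p x
    using gD[OF that] slot(1,2)[of p "lev p"] kk(2)[of p "lev p"]
    by (simp add: mk_def Let_def lev_def ls lane_shift_def)
  moreover have "p = q" if "g p = Some x" "g q = Some y" "level x = level y" "lane x = lane y" for p q x y
  proof -
    have "lev p = lev q" "kk (lev p) p = kk (lev q) q"
      using that(3,4) gD(2)[OF that(1)] gD(2)[OF that(2)] by (simp_all add: mk_def Let_def)
    then show ?thesis
      using inj_onD[OF kk(1)[of "lev p"], of p q] gD(1)[OF that(1)] gD(1)[OF that(2)] by simp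
  qed
  moreover have "s = T \<and> p = q" if "g p = Some x" "s \<le> T" "?J s q = Some y" "level x = level y"
      "stream x = stream y" "landing T x = landing s y" for p x s q y
  proof (cases "s = T")
    case True
    then have y: "g q = Some y" using that(3) by simp
    have e: "lev p = lev q"
      using that(4) gD(2)[OF that(1)] gD(2)[OF y] by (simp add: mk_def Let_def)
    have "p = q"
      using inj_onD[OF sl(1)[of "lev p"], of p q] gD[OF that(1)] gD[OF y] e that(5,6) True
      by (simp add: slot_of_def mk_def Let_def landing_def)
    then show ?thesis using True by simp
  next
    case False
    then have s: "s < T" "J s q = Some y" using that(2,3) by simp_all
    have "landing s y \<noteq> landing T x"
      using slot(3)[OF gD(1)[OF that(1)] s] that(4,5) gD(2)[OF that(1)]
      by (simp add: mk_def Let_def landing_def)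
    then show ?thesis using that(6) by simp
  qed
  ultimately have "schedule_step B arr c ?J T"
    unfolding schedule_step_def fun_upd_same by blast
  then show ?thesis by blast
qed

end

subsection \<open>Causal schedules and their hops\<close>

lemma ex_causal_schedule:
  "\<exists>F :: (nat \<Rightarrow> 'p::linorder option) \<Rightarrow> (nat \<Rightarrow> bool) \<Rightarrow> nat \<Rightarrow> 'p \<Rightarrow> journey option.
     (\<forall>arr arr' c c' t. (\<forall>s\<le>t. arr s = arr' s \<and> c s = c' s) \<longrightarrow> F arr c t = F arr' c' t) \<and>
     (\<forall>arr c t. admissible_arrivals arr \<longrightarrow> schedule_step B arr c (F arr c) t)"
proof -
  \<comment> \<open>Admissibility of the whole input would look into the future; the condition for
    slot \<open>t\<close> may assume it only up to \<open>t\<close>.\<close>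
  define adm where "adm t arr \<longleftrightarrow> arr 0 = None \<and>
    (\<forall>s\<le>t. \<forall>s'\<le>t. \<forall>p. arr s = Some p \<longrightarrow> arr s' = Some p \<longrightarrow> s = s')"
    for t and arr :: "nat \<Rightarrow> 'p option"
  define P where "P t w J \<longleftrightarrow> (adm t (fst \<circ> w) \<longrightarrow> schedule_step B (fst \<circ> w) (snd \<circ> w) J t)"
    for t and w :: "nat \<Rightarrow> 'p option \<times> bool" and J
  have "\<exists>F. (\<forall>w w' t. (\<forall>s\<le>t. w s = w' s) \<longrightarrow> F w t = F w' t) \<and> (\<forall>w t. P t w (F w))"
  proof (rule causal_choice)
    fix t and w w' :: "nat \<Rightarrow> 'p option \<times> bool" and f f'
    assume *: "\<And>s. s \<le> t \<Longrightarrow> w s = w' s \<and> f s = f' s" and "P t w f"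
    moreover have "adm t (fst \<circ> w) = adm t (fst \<circ> w')"
      using * unfolding adm_def by simp
    moreover have "schedule_step B (fst \<circ> w) (snd \<circ> w) f t = schedule_step B (fst \<circ> w') (snd \<circ> w') f' t"
      by (rule schedule_step_cong) (use * in simp)
    ultimately show "P t w' f'" by (simp add: P_def)
  next
    fix t and w :: "nat \<Rightarrow> 'p option \<times> bool" and J
    assume *: "\<And>s. s < t \<Longrightarrow> P s w J"
    show "\<exists>x. P t w (J(t := x))"
    proof (cases "adm t (fst \<circ> w)")
      case True
      then have "schedule_step B (fst \<circ> w) (snd \<circ> w) J s" if "s < t" for s
        using *[OF that] that by (auto simp: P_def adm_def)
      then interpret schedule B "fst \<circ> w" "snd \<circ> w" J t
        using True by unfold_locales (auto simp: adm_def)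
      show ?thesis using ex_schedule_step unfolding P_def by blast
    qed (simp add: P_def)
  qed
  then obtain F where F: "\<And>w w' t. (\<forall>s\<le>t. w s = w' s) \<Longrightarrow> F w t = F w' t" "\<And>w t. P t w (F w)"
    by blast
  let ?F = "\<lambda>arr c. F (\<lambda>s. (arr s, c s))"
  have "schedule_step B arr c (?F arr c) t" if "admissible_arrivals arr" for arr c t
    using F(2)[of t "\<lambda>s. (arr s, c s)"] that
    by (simp add: P_def adm_def admissible_arrivals_def comp_def)
  moreover have "?F arr c t = ?F arr' c' t" if "\<forall>s\<le>t. arr s = arr' s \<and> c s = c' s" for arr arr' c c' t
    by (rule F(1)) (use that in simp)
  ultimately show ?thesis by (intro exI[of _ ?F]) blast
qed

section \<open>From journeys to fiber hops\<close>

datatype fiber = Stage nat nat nat | Final nat nat nat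

fun fiber_delay :: "fiber \<Rightarrow> nat" where
  "fiber_delay (Stage i k j) = 2 ^ j"
| "fiber_delay (Final i h m) = m * 2 ^ i"

text \<open>Stage fibers are private to a lane, while final fibers are shared by all lanes of a
  level and told apart by stream and number of turns. Granting every level the same \<open>L\<close>
  stages makes the count a product, quadratic in \<open>L\<close>.\<close>

definition fibers :: "nat \<Rightarrow> fiber set" where
  "fibers L = (\<lambda>(i, k, j). Stage i k j) ` ({..L} \<times> {..<3001} \<times> {..<L}) \<union>
     (\<lambda>(i, h, m). Final i h m) ` ({..L} \<times> {..<1000} \<times> {1..7})"

lemma fibers_iff [simp]:
  "Stage i k j \<in> fibers L \<longleftrightarrow> i \<le> L \<and> k < 3001 \<and> j < L"
  "Final i h m \<in> fibers L \<longleftrightarrow> i \<le> L \<and> h < 1000 \<and> 1 \<le> m \<and> m \<le> 7"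
  by (auto simp: fibers_def image_iff)

lemma card_fibers: "finite (fibers L) \<and> card (fibers L) = (L + 1) * (3001 * L + 7000)"
proof -
  let ?S = "(\<lambda>(i, k, j). Stage i k j) ` ({..L} \<times> {..<3001} \<times> {..<L})"
  let ?F = "(\<lambda>(i, h, m). Final i h m) ` ({..L} \<times> {..<1000} \<times> {1..7})"
  have "card ?S = (L + 1) * (3001 * L)"
    by (subst card_image) (simp_all add: inj_on_def card_cartesian_product)
  moreover have "card ?F = (L + 1) * 7000"
    by (subst card_image) (simp_all add: inj_on_def card_cartesian_product)
  moreover have "card (?S \<union> ?F) = card ?S + card ?F"
    by (intro card_Un_disjoint) auto
  ultimately show ?thesis by (simp add: fibers_def algebra_simps)
qed

lemma fiber_delay_pos: "f \<in> fibers L \<Longrightarrow> 0 < fiber_delay f"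
  by (auto simp: fibers_def)

text \<open>
  A stage whose digit is 0 is skipped: then \<open>stop s x (Suc j) = stop s x j\<close>.
\<close>

definition stop :: "nat \<Rightarrow> journey \<Rightarrow> nat \<Rightarrow> nat" where
  "stop s x j = (if j \<le> level x then s + shift x mod 2 ^ j else landing s x)"

definition leg :: "journey \<Rightarrow> nat \<Rightarrow> fiber" where
  "leg x j = (if j < level x then Stage (level x) (lane x) j else Final (level x) (stream x) (turns x))"

text \<open>The strict inequality leaves out the skipped stages, where no fiber is entered.\<close>

definition hop :: "(nat \<Rightarrow> 'p \<Rightarrow> journey option) \<Rightarrow> nat \<Rightarrow> 'p \<Rightarrow> fiber \<Rightarrow> bool" where
  "hop J t p f \<longleftrightarrow> (\<exists>s x j. J s p = Some x \<and> j \<le> level x \<and> stop s x j = t \<and>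
     t < stop s x (Suc j) \<and> f = leg x j)"

lemma stop_0: "stop s x 0 = s" by (simp add: stop_def)

lemma stop_end: "stop s x (Suc (level x)) = landing s x" by (simp add: stop_def)

lemma stop_Suc:
  assumes "shift x < 2 ^ level x" "j \<le> level x"
  shows "stop s x (Suc j) = stop s x j \<or> stop s x (Suc j) = stop s x j + fiber_delay (leg x j)"
proof (cases "j < level x")
  case True
  have "shift x mod 2 ^ Suc j = 2 ^ j * (shift x div 2 ^ j mod 2) + shift x mod 2 ^ j"
    using mod_mult2_eq[of "shift x" "2 ^ j" 2] by (simp add: mult.commute)
  moreover have "shift x div 2 ^ j mod 2 = 0 \<or> shift x div 2 ^ j mod 2 = 1" by auto
  ultimately show ?thesis using True by (auto simp: stop_def leg_def)
next
  case False
  then show ?thesis using assms by (simp add: stop_def leg_def landing_def)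
qed

lemma stop_mono:
  assumes "shift x < 2 ^ level x" "j \<le> j'" "j' \<le> Suc (level x)"
  shows "stop s x j \<le> stop s x j'"
  using assms(2,3)
proof (induction j' rule: dec_induct)
  case (step n)
  then have "stop s x n \<le> stop s x (Suc n)" using stop_Suc[OF assms(1), of n s] by auto
  then show ?case using step by simp
qed simp

text \<open>No stop precedes the start of its journey, so hops at \<open>t\<close> come from
  journeys started by then; this makes the routing causal.\<close>

lemma hop_cong:
  assumes "\<And>s. s \<le> t \<Longrightarrow> J s = J' s"
  shows "hop J t p f = hop J' t p f"
proof -
  have *: "hop K' t p f" if "hop K t p f" "\<And>s. s \<le> t \<Longrightarrow> K s = K' s" for K K'
  proof -
    from that(1) obtain s x j where x: "K s p = Some x" "j \<le> level x" "stop s x j = t"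
      "t < stop s x (Suc j)" "f = leg x j" unfolding hop_def by blast
    moreover have "s \<le> t" using x(2,3) by (auto simp: stop_def)
    ultimately have "K' s p = Some x" using that(2) by simp
    with x show ?thesis unfolding hop_def by blast
  qed
  show ?thesis using *[of J J'] *[of J' J] assms by auto
qed

lemma ex_crossing:
  fixes f :: "nat \<Rightarrow> nat"
  shows "f 0 \<le> t \<Longrightarrow> t < f n \<Longrightarrow> \<exists>j<n. f j \<le> t \<and> t < f (Suc j)"
proof (induction n)
  case (Suc n)
  then show ?case by (cases "t < f n") (auto intro: less_SucI)
qed simp

locale full_schedule =
  fixes B :: nat and arr :: "nat \<Rightarrow> 'p::linorder option" and c :: "nat \<Rightarrow> bool"
    and J :: "nat \<Rightarrow> 'p \<Rightarrow> journey option"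
  assumes admissible: "admissible_arrivals arr"
    and steps: "\<And>s. schedule_step B arr c J s"
begin

abbreviation Q :: "nat \<Rightarrow> 'p set" where "Q \<equiv> queue B arr c"

lemma upto: "schedule B arr c J T"
  using admissible steps by unfold_locales (auto simp: admissible_arrivals_def)

text \<open>The finite-horizon facts hold at every slot, since the horizon can be chosen large
  enough for the slots concerned.\<close>

lemmas start_iff = schedule.start_iff[OF upto lessI]
  and start_level = schedule.start_level[OF upto lessI]
  and start_lane = schedule.start_lane[OF upto lessI]
  and start_turns = schedule.start_turns[OF upto lessI]
  and start_stream = schedule.start_stream[OF upto lessI]
  and start_queue = schedule.start_queue[OF upto lessI]
  and lane_unique = schedule.lane_unique[OF upto lessI]
  and shift_less = schedule.shift_less[OF upto lessI]
  and shift_mod = schedule.shift_mod[OF upto lessI]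
  and start_less_landing = schedule.start_less_landing[OF upto lessI]
  and in_queue_until_landing = schedule.in_queue_until_landing[OF upto lessI]
  and journeys_disjoint = schedule.journeys_disjoint[OF upto _ lessI]
  and not_queue_before_arrival = schedule.not_queue_before_arrival[OF upto _ order_refl]

lemma landing_unique:
  assumes "J s p = Some x" "J s' q = Some y" "level x = level y"
    "stream x = stream y" "landing s x = landing s' y"
  shows "p = q"
proof -
  have "s < Suc (max s s')" "s' < Suc (max s s')" by simp_all
  from schedule.landing_unique[OF upto this assms] show ?thesis ..
qed

lemma ex_journey: "p \<in> Q t \<Longrightarrow> \<exists>s x. J s p = Some x \<and> s \<le> t \<and> t < landing s x"
proof (induction t)
  case (Suc t)
  show ?case
  proof (cases "at_switch arr J (Suc t) p")
    case True
    then obtain x where "J (Suc t) p = Some x" using start_iff Suc.prems by blast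
    then show ?thesis using start_less_landing by blast
  next
    case False
    then have "p \<in> Q t"
      using queue_Suc_subset[of B arr c t] Suc.prems by (auto simp: at_switch_def)
    then obtain s x where x: "J s p = Some x" "s \<le> t" "t < landing s x" using Suc.IH by blast
    moreover have "landing s x \<noteq> Suc t"
      using False x by (auto simp: at_switch_def)
    ultimately show ?thesis by (intro exI[of _ s] exI[of _ x]) simp
  qed
qed simp

lemma hop_covers:
  assumes "p \<in> Q t" shows "\<exists>s f. hop J s p f \<and> s \<le> t \<and> t < s + fiber_delay f"
proof -
  obtain s x where x: "J s p = Some x" "s \<le> t" "t < landing s x" using ex_journey[OF assms] by blast
  obtain j where j: "j \<le> level x" "stop s x j \<le> t" "t < stop s x (Suc j)"
    using ex_crossing[of "stop s x" t "Suc (level x)"] x by (auto simp: stop_0 stop_end less_Suc_eq_le)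
  then have "stop s x (Suc j) = stop s x j + fiber_delay (leg x j)"
    using stop_Suc[OF shift_less[OF x(1)] j(1), of s] by auto
  moreover have "hop J (stop s x j) p (leg x j)" 
    unfolding hop_def using x(1) j by (intro exI[of _ s] exI[of _ x] exI[of _ j]) simp
  ultimately show ?thesis using j by metis
qed

lemma hopE:
  assumes "hop J t p f"
  obtains s x j where "J s p = Some x" "j \<le> level x" "stop s x j = t" "f = leg x j"
    "stop s x (Suc j) = t + fiber_delay f" "t < t + fiber_delay f" "s \<le> t" "t + fiber_delay f \<le> landing s x"
proof -
  obtain s x j where x: "J s p = Some x" "j \<le> level x" "stop s x j = t" "t < stop s x (Suc j)" "f = leg x j"
    using assms by (auto simp: hop_def)
  have sh: "shift x < 2 ^ level x" using shift_less[OF x(1)] .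
  have 1: "stop s x (Suc j) = t + fiber_delay f" using stop_Suc[OF sh x(2), of s] x by auto
  have 2: "s \<le> t" using stop_mono[OF sh, of 0 j s] x by (simp add: stop_0)
  have 3: "t + fiber_delay f \<le> landing s x"
    using stop_mono[OF sh, of "Suc j" "Suc (level x)" s] x(2) 1 by (simp add: stop_end)
  show ?thesis using that[OF x(1,2,3,5) 1 _ 2 3] x(4) 1 by simp
qed

lemma hop_in_queue:
  assumes "hop J t p f" "t \<le> u" "u < t + fiber_delay f" shows "p \<in> Q u"
  using assms(1)
proof (rule hopE)
  fix s x j assume "J s p = Some x" "s \<le> t" "t + fiber_delay f \<le> landing s x"
  then show ?thesis using in_queue_until_landing[of s p x u] assms(2,3) by simp
qed

text \<open>Different journeys of a packet do not overlap, and within one journey the stops are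
  ordered.\<close>

lemma hop_disjoint:
  assumes "hop J t p f" "hop J t' p f'" "t \<le> t'" "t' < t + fiber_delay f"
  shows "t = t' \<and> f = f'"
proof -
  obtain s x j where x: "J s p = Some x" "j \<le> level x" "stop s x j = t" "f = leg x j"
    "stop s x (Suc j) = t + fiber_delay f" "s \<le> t" "t + fiber_delay f \<le> landing s x"
    using assms(1) by (rule hopE)
  obtain s' x' j' where x': "J s' p = Some x'" "j' \<le> level x'" "stop s' x' j' = t'" "f' = leg x' j'"
    "stop s' x' (Suc j') = t' + fiber_delay f'" "t' < t' + fiber_delay f'" "s' \<le> t'" "t' + fiber_delay f' \<le> landing s' x'"
    using assms(2) by (rule hopE)
  have "\<not> s < s'" using journeys_disjoint[of s s' p x x'] x x' assms(4) by auto
  moreover have "\<not> s' < s" using journeys_disjoint[of s' s p x' x] x x' assms(3) by auto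
  ultimately have s: "s' = s" "x' = x" using x(1) x'(1) by auto
  have sh: "shift x < 2 ^ level x" using shift_less[OF x(1)] .
  have "\<not> j < j'"
    using stop_mono[OF sh, of "Suc j" j' s] x x' s assms(4) by auto
  moreover have "\<not> j' < j"
    using stop_mono[OF sh, of "Suc j'" j s] x x' s assms(3) by auto
  ultimately show ?thesis using x x' s by auto
qed

text \<open>No collisions in stage fibers: equal slots before stage \<open>j\<close> force counters
  congruent modulo \<open>2 ^ j\<close>. If \<open>s < s'\<close>, the counter grows strictly, hence
  by at least \<open>2 ^ j\<close>; but it grows by at most one per slot, and the shared stop puts
  \<open>s\<close> and \<open>s'\<close> less than \<open>2 ^ j\<close> apart.\<close>

lemma stage_injective:
  assumes "J s p = Some x" "J s' q = Some y" "level x = level y" "lane x = lane y" "j \<le> level x"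
    and eq: "s + shift x mod 2 ^ j = s' + shift y mod 2 ^ j"
  shows "s = s'"
proof -
  have False if "s < s'" "J s p = Some x" "J s' q = Some y" "level x = level y" "lane x = lane y"
    "j \<le> level x" "s + shift x mod 2 ^ j = s' + shift y mod 2 ^ j" for s s' p q x y
  proof -
    let ?n = "\<lambda>s. card (lane_starts J s (level x) (lane x))"
    have fin: "finite (lane_starts J r (level x) (lane x))" for r
      by (rule finite_subset[of _ "{..<r}"]) (auto simp: lane_starts_def)
    have "lane_starts J s (level x) (lane x) \<subset> lane_starts J s' (level x) (lane x)"
      using that(1,2) by (force simp: lane_starts_def)
    then have lt: "?n s < ?n s'" by (intro psubset_card_mono fin)
    have "lane_starts J s' (level x) (lane x) \<subseteq> lane_starts J s (level x) (lane x) \<union> {s..<s'}"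
      by (auto simp: lane_starts_def)
    then have "?n s' \<le> card (lane_starts J s (level x) (lane x) \<union> {s..<s'})"
      using fin by (intro card_mono) simp_all
    also have "\<dots> \<le> ?n s + card {s..<s'}" by (rule card_Un_le)
    finally have le: "?n s' \<le> ?n s + (s' - s)" by simp
    have "?n s mod 2 ^ j = ?n s' mod 2 ^ j"
      using shift_mod[OF that(2), of j] shift_mod[OF that(3), of j] that by simp
    then have "?n s + 2 ^ j \<le> ?n s'" using lt by (intro mod_eq_less_spaced)
    moreover have "s' - s < 2 ^ j"
    proof -
      have "shift x mod 2 ^ j < 2 ^ j" by simp
      then show ?thesis using that(7) by linarith
    qed
    ultimately show False using le by simp
  qed
  from this[of s s' p x q y] this[of s' s q y p x] show ?thesis using assms by (metis linorder_less_linear)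
qed

text \<open>In a stage fiber \<open>stage_injective\<close> gives equal starts, and a lane has one
  start per slot. In a final fiber equal entry slots mean equal landing slots on the same
  stream.\<close>

lemma hop_injective:
  assumes "hop J t p f" "hop J t q f" shows "p = q"
proof -
  obtain s x j where x: "J s p = Some x" "j \<le> level x" "stop s x j = t" "f = leg x j"
    using assms(1) by (rule hopE)
  obtain s' y j' where y: "J s' q = Some y" "j' \<le> level y" "stop s' y j' = t" "f = leg y j'"
    using assms(2) by (rule hopE)
  show ?thesis
  proof (cases "j < level x")
    case True
    then have e: "j' = j" "level x = level y" "lane x = lane y"
      using x(4) y(4) by (auto simp: leg_def split: if_splits)
    have "s = s'"
      using stage_injective[OF x(1) y(1) e(2,3) x(2)] x(3) y(3) e(1) x(2) y(2) by (simp add: stop_def)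
    then show ?thesis using lane_unique[of s p x q y] x(1) y(1) e by simp
  next
    case False
    then have e: "j = level x" "j' = level y" "level x = level y" "stream x = stream y" "turns x = turns y"
      using x(2,4) y(2,4) by (auto simp: leg_def split: if_splits)
    then have "landing s x = landing s' y"
      using x(3) y(3) shift_less[OF x(1)] shift_less[OF y(1)] by (simp add: stop_def landing_def)
    then show ?thesis using landing_unique[OF x(1) y(1)] e by simp
  qed
qed

lemma hop_fiber:
  assumes "B = 2 ^ L" "hop J t p f" shows "f \<in> fibers L"
  using assms(2)
proof (rule hopE)
  fix s x j assume x: "J s p = Some x" "j \<le> level x" "f = leg x j"
  have "urgency B (Q s) p \<le> B"
    using tag_bounds[OF finite_queue start_queue[OF x(1)]] by (simp add: urgency_def)
  also have "B < 32 * 2 ^ L" using assms(1) by simp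
  finally have "urgency B (Q s) p < 32 * 2 ^ L" .
  then have "level x \<le> L" using start_level[OF x(1)] level_of_le by simp
  moreover have "turns x \<in> {1..7}" using start_turns[OF x(1)] by (auto split: if_splits)
  ultimately show ?thesis
    using x(3) start_lane[OF x(1)] start_stream[OF x(1)] by (auto simp: leg_def)
qed

end

subsection \<open>Realizing hops by a crossbar switch\<close>

declare inp.simps [simp del]

lemma ex_permutation_extending:
  assumes "finite A" "R \<subseteq> A \<times> A"
    and func: "\<And>i j k. (i, j) \<in> R \<Longrightarrow> (i, k) \<in> R \<Longrightarrow> j = k"
    and inj: "\<And>i j k. (i, k) \<in> R \<Longrightarrow> (j, k) \<in> R \<Longrightarrow> i = j"
  shows "\<exists>\<sigma>. bij_betw \<sigma> A A \<and> (\<forall>(i, j)\<in>R. \<sigma> i = j)"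
proof -
  define f where "f i = (THE j. (i, j) \<in> R)" for i
  have f: "f i = j" if "(i, j) \<in> R" for i j
    unfolding f_def using that func by blast
  have sub: "Domain R \<subseteq> A" "Range R \<subseteq> A" using assms(2) by auto
  have bij: "bij_betw f (Domain R) (Range R)"
    unfolding bij_betw_def
  proof
    show "inj_on f (Domain R)"
      by (rule inj_onI) (metis DomainE f inj)
    show "f ` Domain R = Range R" using f by force
  qed
  have fin: "finite (Domain R)" "finite (Range R)" 
    by (rule finite_subset[OF sub(1) assms(1)], rule finite_subset[OF sub(2) assms(1)])
  have "card (A - Domain R) = card (A - Range R)"
    using bij_betw_same_card[OF bij] sub fin by (simp add: card_Diff_subset)
  then obtain g where g: "bij_betw g (A - Domain R) (A - Range R)"
    using finite_same_card_bij[of "A - Domain R" "A - Range R"] assms(1) by auto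
  let ?s = "\<lambda>i. if i \<in> Domain R then f i else g i"
  have "bij_betw ?s (Domain R \<union> (A - Domain R)) (Range R \<union> (A - Range R))"
    by (rule bij_betw_disjoint_Un) (use bij g in auto)
  then have "bij_betw ?s A A" using sub by (simp add: Un_absorb1)
  moreover have "\<forall>(i, j)\<in>R. ?s i = j" using f by auto
  ultimately show ?thesis by blast
qed

text \<open>The default \<open>id\<close> keeps the policy a permutation on inadmissible arrivals.\<close>

definition permutation_extending :: "nat set \<Rightarrow> (nat \<times> nat) set \<Rightarrow> nat \<Rightarrow> nat" where
  "permutation_extending A R =
     (if \<exists>\<sigma>. bij_betw \<sigma> A A \<and> (\<forall>(i, j)\<in>R. \<sigma> i = j)
      then SOME \<sigma>. bij_betw \<sigma> A A \<and> (\<forall>(i, j)\<in>R. \<sigma> i = j) else id)"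

lemma bij_permutation_extending: "bij_betw (permutation_extending A R) A A"
proof (cases "\<exists>\<sigma>. bij_betw \<sigma> A A \<and> (\<forall>(i, j)\<in>R. \<sigma> i = j)")
  case True
  from someI_ex[OF this] show ?thesis using True by (simp add: permutation_extending_def)
next
  case False
  show ?thesis unfolding permutation_extending_def if_not_P[OF False] by simp
qed

lemma permutation_extending_eq:
  assumes "\<exists>\<sigma>. bij_betw \<sigma> A A \<and> (\<forall>(i, j)\<in>R. \<sigma> i = j)" "(i, j) \<in> R"
  shows "permutation_extending A R i = j"
  using someI_ex[OF assms(1)] assms by (auto simp: permutation_extending_def)

section \<open>Intended traffic through the switch\<close>

definition at_input :: "nat \<Rightarrow> (nat \<Rightarrow> nat) \<Rightarrow> (nat \<Rightarrow> 'p option) \<Rightarrow> (nat \<Rightarrow> 'p \<Rightarrow> nat \<Rightarrow> bool)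
    \<Rightarrow> nat \<Rightarrow> nat \<Rightarrow> 'p \<Rightarrow> bool" where
  "at_input M d arr hp t i p \<longleftrightarrow>
     i = 0 \<and> arr t = Some p \<or> i \<in> {1..M} \<and> d i \<le> t \<and> hp (t - d i) p i"

definition to_output :: "nat \<Rightarrow> nat \<Rightarrow> (nat \<Rightarrow> 'p::linorder option) \<Rightarrow> (nat \<Rightarrow> bool)
    \<Rightarrow> (nat \<Rightarrow> 'p \<Rightarrow> nat \<Rightarrow> bool) \<Rightarrow> nat \<Rightarrow> nat \<Rightarrow> 'p \<Rightarrow> bool" where
  "to_output M B arr c hp t k p \<longleftrightarrow> k \<in> {1..M} \<and> hp t p k \<or>
     0 < t \<and> p \<in> queue B arr c (t - 1) \<union> set_option (arr t) - queue B arr c t \<and>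
     k = (if c t then 0 else M + 1)"

definition switching :: "nat \<Rightarrow> nat \<Rightarrow> (nat \<Rightarrow> nat) \<Rightarrow> (nat \<Rightarrow> 'p::linorder option) \<Rightarrow> (nat \<Rightarrow> bool)
    \<Rightarrow> (nat \<Rightarrow> 'p \<Rightarrow> nat \<Rightarrow> bool) \<Rightarrow> nat \<Rightarrow> nat \<Rightarrow> nat" where
  "switching M B d arr c hp t = permutation_extending {..M + 1}
     {(i, k). \<exists>p. at_input M d arr hp t i p \<and> to_output M B arr c hp t k p}"

lemma switching_cong:
  assumes "\<And>s. s \<le> t \<Longrightarrow> arr s = arr' s \<and> c s = c' s \<and> hp s = hp' s"
  shows "switching M B d arr c hp t = switching M B d arr' c' hp' t"
proof -
  have "queue B arr c t = queue B arr' c' t" "queue B arr c (t - 1) = queue B arr' c' (t - 1)"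
    by (rule queue_cong; use assms in simp)+
  then have "to_output M B arr c hp t = to_output M B arr' c' hp' t"
    using assms[of t] by (intro ext) (simp add: to_output_def)
  moreover have "at_input M d arr hp t = at_input M d arr' hp' t"
    using assms by (intro ext) (simp add: at_input_def)
  ultimately show ?thesis by (simp add: switching_def)
qed

text \<open>What the crossbar requires of the hops, with fibers numbered by ports: a queued packet
  is in exactly one fiber at each slot, and no two packets enter a fiber together.\<close>

locale network =
  fixes M B :: nat and d :: "nat \<Rightarrow> nat" and arr :: "nat \<Rightarrow> 'p::linorder option"
    and c :: "nat \<Rightarrow> bool" and hp :: "nat \<Rightarrow> 'p \<Rightarrow> nat \<Rightarrow> bool"
  assumes admissible: "admissible_arrivals arr"
    and delay_pos: "\<And>j. j \<in> {1..M} \<Longrightarrow> 0 < d j"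
    and hp_port: "\<And>t p j. hp t p j \<Longrightarrow> j \<in> {1..M}"
    and hp_queue: "\<And>t p j u. hp t p j \<Longrightarrow> t \<le> u \<Longrightarrow> u < t + d j \<Longrightarrow> p \<in> queue B arr c u"
    and hp_inj: "\<And>t p q j. hp t p j \<Longrightarrow> hp t q j \<Longrightarrow> p = q"
    and hp_disjoint: "\<And>t t' p j j'. hp t p j \<Longrightarrow> hp t' p j' \<Longrightarrow> t \<le> t' \<Longrightarrow> t' < t + d j \<Longrightarrow> t = t' \<and> j = j'"
    and hp_covers: "\<And>t p. p \<in> queue B arr c t \<Longrightarrow> \<exists>s j. hp s p j \<and> s \<le> t \<and> t < s + d j"
begin

abbreviation Q :: "nat \<Rightarrow> 'p set" where "Q \<equiv> queue B arr c"
abbreviation inlet :: "nat \<Rightarrow> nat \<Rightarrow> 'p \<Rightarrow> bool" where "inlet \<equiv> at_input M d arr hp"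
abbreviation outlet :: "nat \<Rightarrow> nat \<Rightarrow> 'p \<Rightarrow> bool" where "outlet \<equiv> to_output M B arr c hp"
abbreviation \<sigma> :: "nat \<Rightarrow> nat \<Rightarrow> nat" where "\<sigma> \<equiv> switching M B d arr c hp"

lemma arr0: "arr 0 = None" using admissible by (simp add: admissible_arrivals_def)

lemma not_queue_before_arrival:
  assumes "s < t" "arr t = Some p" shows "p \<notin> Q s"
proof
  assume "p \<in> Q s"
  then obtain a where a: "a \<in> {0<..s}" "arr a = Some p" using queue_arrived by blast
  then have "a = t" using admissible assms(2) unfolding admissible_arrivals_def by blast
  then show False using a assms(1) by simp
qed

lemma hp_start_queue: "hp t p j \<Longrightarrow> p \<in> Q t"
  using hp_queue[of t p j t] delay_pos[OF hp_port] by simp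

lemma hp_unique: "hp t p j \<Longrightarrow> hp t p j' \<Longrightarrow> j = j'"
  using hp_disjoint[of t p j t j'] delay_pos[OF hp_port] by simp

lemma hp_end_unique:
  assumes "hp s p j" "hp s' p j'" "s + d j = s' + d j'" shows "s = s' \<and> j = j'"
  using hp_disjoint[of s p j s' j'] hp_disjoint[of s' p j' s j] assms
    delay_pos[OF hp_port[OF assms(1)]] delay_pos[OF hp_port[OF assms(2)]]
  by (cases "s \<le> s'") auto

lemma inlet_fiber:
  assumes "inlet t i p" "arr t \<noteq> Some p"
  obtains s where "hp s p i" "t = s + d i" "s < t"
  using assms delay_pos[of i] that[of "t - d i"] unfolding at_input_def by auto

lemma inlet_arrival: "inlet t i p \<Longrightarrow> arr t = Some p \<Longrightarrow> i = 0"
proof (rule ccontr)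
  assume *: "inlet t i p" "arr t = Some p" "i \<noteq> 0"
  then have i: "i \<in> {1..M}" "d i \<le> t" "hp (t - d i) p i" unfolding at_input_def by auto
  then have "t - d i < t" using delay_pos[of i] by simp
  then show False
    using not_queue_before_arrival[OF _ *(2)] hp_start_queue[OF i(3)] by blast
qed

lemma inlet_unique: assumes "inlet t i p" "inlet t j p" shows "i = j"
proof (cases "arr t = Some p")
  case True
  then show ?thesis using inlet_arrival assms by blast
next
  case False
  obtain s s' where "hp s p i" "t = s + d i" "hp s' p j" "t = s' + d j"
    using inlet_fiber[OF assms(1) False] inlet_fiber[OF assms(2) False] by metis
  then show ?thesis using hp_end_unique by blast
qed

lemma inlet_inj: "inlet t i p \<Longrightarrow> inlet t i q \<Longrightarrow> p = q"
  using hp_inj unfolding at_input_def by auto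

lemma removed_unique:
  assumes "0 < t" "p \<in> Q (t - 1) \<union> set_option (arr t) - Q t" "q \<in> Q (t - 1) \<union> set_option (arr t) - Q t"
  shows "p = q"
proof -
  obtain u where u: "t = Suc u" using assms(1) gr0_conv_Suc by blast
  show ?thesis using assms(2,3) unfolding u
    by (auto simp: queue.simps(2) Let_def split: if_splits)
qed

lemma outlet_inj: "outlet t k p \<Longrightarrow> outlet t k q \<Longrightarrow> p = q"
  using hp_inj[of t p k q] removed_unique[of t p q] unfolding to_output_def
  by (auto split: if_splits)

lemma outlet_unique: "outlet t k p \<Longrightarrow> outlet t l p \<Longrightarrow> k = l"
  using hp_unique[of t p k l] hp_start_queue[of t p] unfolding to_output_def by blast

lemma outlet_hp: "k \<in> {1..M} \<Longrightarrow> outlet t k p \<longleftrightarrow> hp t p k"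
  unfolding to_output_def by auto

text \<open>A packet at an input has just arrived or just finished a hop. If it stays in the queue,
  the hop covering \<open>t\<close> can only begin at \<open>t\<close>, for an earlier one would
  precede the arrival or overlap with the finished hop. Otherwise it is removed in this
  slot.\<close>

lemma inlet_imp_outlet:
  assumes "inlet t i p" shows "\<exists>k. outlet t k p"
proof (cases "p \<in> Q t")
  case True
  then obtain s j where s: "hp s p j" "s \<le> t" "t < s + d j" using hp_covers by blast
  have "s = t"
  proof (rule ccontr)
    assume "s \<noteq> t"
    then have "s < t" using s by simp
    then have "arr t \<noteq> Some p"
      using not_queue_before_arrival hp_start_queue[OF s(1)] by blast
    then obtain r where r: "hp r p i" "t = r + d i" "r < t" using inlet_fiber[OF assms] by blast
    have "r = s \<and> i = j"
      using hp_disjoint[OF r(1) s(1)] hp_disjoint[OF s(1) r(1)] r s \<open>s < t\<close> by (cases "r \<le> s") auto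
    then show False using r s by simp
  qed
  then show ?thesis using s(1) outlet_hp[OF hp_port[OF s(1)]] by blast
next
  case False
  have "0 < t \<and> p \<in> Q (t - 1) \<union> set_option (arr t)"
  proof (cases "arr t = Some p")
    case True
    then show ?thesis using arr0 by (cases t) auto
  next
    case False
    then obtain s where s: "hp s p i" "t = s + d i" "s < t" using inlet_fiber[OF assms] by blast
    then show ?thesis using hp_queue[OF s(1), of "t - 1"] by simp
  qed
  then show ?thesis using False unfolding to_output_def by blast
qed

text \<open>Unless it arrives now, the packet was queued at \<open>t - 1\<close>. The hop covering
  that slot must end at \<open>t\<close>, since a packet still inside a fiber at \<open>t\<close> is
  neither removed nor able to enter another one.\<close>

lemma outlet_imp_inlet:
  assumes "outlet t k p" shows "\<exists>i. inlet t i p"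
proof (cases "arr t = Some p")
  case True
  then show ?thesis unfolding at_input_def by blast
next
  case False
  have "0 < t \<and> p \<in> Q (t - 1)"
  proof (cases "hp t p k")
    case True
    then have "p \<in> Q t" by (rule hp_start_queue)
    then show ?thesis using False queue_Suc_subset[of B arr c "t - 1"] by (cases t) auto
  next
    case False
    then show ?thesis using assms \<open>arr t \<noteq> Some p\<close> unfolding to_output_def by auto
  qed
  then obtain s j where t: "0 < t" and s: "hp s p j" "s \<le> t - 1" "t - 1 < s + d j" using hp_covers by blast
  have "\<not> t < s + d j"
  proof
    assume *: "t < s + d j"
    then have "p \<in> Q t" using hp_queue[OF s(1), of t] s(2) by simp
    then have "hp t p k" using assms unfolding to_output_def by auto
    moreover have "s < t" using s(2) t by simp
    ultimately show False using hp_disjoint[OF s(1), of t k] * by simp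
  qed
  then have "t = s + d j" using s(3) by simp
  then show ?thesis using s(1) hp_port[OF s(1)] unfolding at_input_def by (intro exI[of _ j]) simp
qed

lemma inlet_le: "inlet t i p \<Longrightarrow> i \<le> M + 1" unfolding at_input_def by auto

lemma outlet_le: "outlet t k p \<Longrightarrow> k \<le> M + 1" unfolding to_output_def by (auto split: if_splits)

lemma bij_\<sigma>: "bij_betw (\<sigma> t) {..M + 1} {..M + 1}"
  unfolding switching_def by (rule bij_permutation_extending)

lemma \<sigma>_eq: "inlet t i p \<Longrightarrow> outlet t k p \<Longrightarrow> \<sigma> t i = k"
  unfolding switching_def
proof (rule permutation_extending_eq)
  show "\<exists>\<sigma>. bij_betw \<sigma> {..M + 1} {..M + 1} \<and>
      (\<forall>(i, j)\<in>{(i, k). \<exists>p. inlet t i p \<and> outlet t k p}. \<sigma> i = j)"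
  proof (rule ex_permutation_extending)
    show "{(i, k). \<exists>p. inlet t i p \<and> outlet t k p} \<subseteq> {..M + 1} \<times> {..M + 1}"
      using inlet_le outlet_le by auto
    fix i j k
    { assume "(i, j) \<in> {(i, k). \<exists>p. inlet t i p \<and> outlet t k p}"
        "(i, k) \<in> {(i, k). \<exists>p. inlet t i p \<and> outlet t k p}"
      then show "j = k" using inlet_inj outlet_unique by blast }
    { assume "(i, k) \<in> {(i, k). \<exists>p. inlet t i p \<and> outlet t k p}"
        "(j, k) \<in> {(i, k). \<exists>p. inlet t i p \<and> outlet t k p}"
      then show "i = j" using outlet_inj inlet_unique by blast }
  qed simp
qed blast

lemma \<sigma>_inverse: "i \<le> M + 1 \<Longrightarrow> \<sigma> t i = k \<Longrightarrow> (THE k'. k' \<le> M + 1 \<and> \<sigma> t k' = k) = i"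
  using bij_\<sigma>[of t] by (intro the_equality) (auto simp: bij_betw_def inj_on_def)

lemma \<sigma>_surj: "k \<le> M + 1 \<Longrightarrow> \<exists>i\<le>M + 1. \<sigma> t i = k"
  using bij_betw_imp_surj_on[OF bij_\<sigma>[of t]] by (metis atMost_iff imageE)

text \<open>If the inputs carry the intended traffic, so do the outputs; the equivalence also
  ensures that outputs meant to be idle receive nothing.\<close>

lemma routed_iff:
  assumes "k \<le> M + 1" "\<And>i. i \<le> M + 1 \<Longrightarrow> inp M d \<sigma> arr t i = Some p \<longleftrightarrow> inlet t i p"
  shows "inp M d \<sigma> arr t (THE i. i \<le> M + 1 \<and> \<sigma> t i = k) = Some p \<longleftrightarrow> outlet t k p"
proof -
  obtain i where i: "i \<le> M + 1" "\<sigma> t i = k" using \<sigma>_surj[OF assms(1)] by blast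
  have "inlet t i p \<longleftrightarrow> outlet t k p"
  proof
    assume "inlet t i p"
    moreover from this obtain k' where "outlet t k' p" using inlet_imp_outlet by blast
    ultimately show "outlet t k p" using \<sigma>_eq i(2) by blast
  next
    assume o: "outlet t k p"
    then obtain i' where i': "inlet t i' p" using outlet_imp_inlet by blast
    then have "\<sigma> t i' = \<sigma> t i" using \<sigma>_eq o i(2) by simp
    then have "i' = i"
      using bij_betw_imp_inj_on[OF bij_\<sigma>[of t]] i(1) inlet_le[OF i'] by (simp add: inj_on_def)
    then show "inlet t i p" using i' by simp
  qed
  then show ?thesis using \<sigma>_inverse[OF i] assms(2)[OF i(1)] by simp
qed

text \<open>Induction on time: what a fiber delivers at \<open>t\<close> left the switch at
  \<open>t - d i\<close>, which is earlier because delays are positive.\<close>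

lemma inp_iff: "i \<le> M + 1 \<Longrightarrow> inp M d \<sigma> arr t i = Some p \<longleftrightarrow> inlet t i p"
proof (induction t arbitrary: i rule: less_induct)
  case (less t)
  show ?case
  proof (cases "i \<in> {1..M} \<and> d i \<le> t")
    case True
    then have lt: "t - d i < t" and i: "i \<in> {1..M}" using delay_pos[of i] by auto
    have "inp M d \<sigma> arr t i = inp M d \<sigma> arr (t - d i) (THE k. k \<le> M + 1 \<and> \<sigma> (t - d i) k = i)"
      using True delay_pos[of i] by (subst inp.simps) auto
    then show ?thesis
      using routed_iff[OF less.prems, of "t - d i" p] less.IH[OF lt] outlet_hp[OF i] True
      by (auto simp: at_input_def)
  next
    case False
    then show ?thesis
      using less.prems by (subst inp.simps) (auto simp: at_input_def)
  qed
qed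

lemma outp_iff: "k \<le> M + 1 \<Longrightarrow> outp M d \<sigma> arr t k = Some p \<longleftrightarrow> outlet t k p"
  using routed_iff[OF _ inp_iff] \<sigma>_surj[of k t] unfolding outp_def by simp

lemma buffered_eq: "buffered M d \<sigma> arr t = Q t"
proof -
  have "p \<in> buffered M d \<sigma> arr t \<longleftrightarrow> (\<exists>s\<le>t. \<exists>j\<in>{1..M}. hp s p j \<and> t < s + d j)" for p
    using outp_iff outlet_hp unfolding buffered_def by simp
  then show ?thesis using hp_port hp_covers hp_queue by blast
qed

lemma pq_behaviour: "pq_behaviour M B d \<sigma> arr c"
  unfolding pq_behaviour_def buffered_eq Let_def
proof (intro allI impI)
  fix t :: nat assume "0 < t"
  then obtain u where t: "t = Suc u" using gr0_conv_Suc by blast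
  let ?S = "Q u \<union> set_option (arr t)"
  let ?dep = "outp M d \<sigma> arr t 0" and ?los = "outp M d \<sigma> arr t (M + 1)"
  have dep: "?dep = Some p \<longleftrightarrow> c t \<and> p \<in> ?S - Q t" for p
    by (subst outp_iff) (auto simp: to_output_def t)
  have los: "?los = Some p \<longleftrightarrow> \<not> c t \<and> p \<in> ?S - Q t" for p
    by (subst outp_iff) (auto simp: to_output_def t)
  have fin: "finite ?S" by simp
  have cardS: "card ?S = card (Q u) + ind (arr t \<noteq> None)"
    using not_queue_before_arrival[of u t] t by (cases "arr t") (auto simp: ind_def)
  have le: "card (Q u) \<le> B" by (rule card_queue_le)
  show "card (Q t) + ind (?dep \<noteq> None) + ind (?los \<noteq> None) = card (Q (t - 1)) + ind (arr t \<noteq> None) \<and>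
    (ind (?dep \<noteq> None) = 1 \<longleftrightarrow> c t \<and> 0 < card (Q (t - 1)) + ind (arr t \<noteq> None)) \<and>
    (ind (?los \<noteq> None) = 1 \<longleftrightarrow> \<not> c t \<and> card (Q (t - 1)) = B \<and> ind (arr t \<noteq> None) = 1) \<and>
    (\<forall>p. ?dep = Some p \<longrightarrow> tag (Q (t - 1) \<union> set_option (arr t)) p = 1) \<and>
    (\<forall>p. ?los = Some p \<longrightarrow> tag (Q (t - 1) \<union> set_option (arr t)) p = B + 1)"
  proof (cases "c t")
    case c: True
    then have los': "?los = None" using los by (cases ?los) auto
    have Qt: "Q t = ?S - {Max ?S}" using c by (simp add: t queue.simps(2) Let_def)
    show ?thesis
    proof (cases "?S = {}")
      case True
      then have "?dep = None" using dep by (cases ?dep) auto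
      then show ?thesis using los' c True Qt cardS by (simp add: t ind_def)
    next
      case False
      have mem: "Max ?S \<in> ?S" by (rule Max_in[OF fin False])
      then have d: "?dep = Some (Max ?S)" using dep c Qt by blast
      have "card (Q t) = card ?S - 1" "0 < card ?S"
        unfolding Qt using mem fin False by (simp_all add: card_Diff_singleton card_gt_0_iff)
      then show ?thesis using los' d c cardS tag_Max[OF fin False] by (simp add: t ind_def)
    qed
  next
    case nc: False
    then have dep': "?dep = None" using dep by (cases ?dep) auto
    have Qt: "Q t = (if card ?S > B then ?S - {Min ?S} else ?S)"
      using nc by (simp add: t queue.simps(2) Let_def)
    show ?thesis
    proof (cases "card ?S > B")
      case True
      then have ne: "?S \<noteq> {}" by (metis card.empty not_less_zero)
      have mem: "Min ?S \<in> ?S" by (rule Min_in[OF fin ne])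
      then have l: "?los = Some (Min ?S)" using los nc Qt True by auto
      have "card (Q t) = card ?S - 1" "0 < card ?S"
        using mem fin ne True by (simp_all add: Qt card_Diff_singleton card_gt_0_iff)
      \<comment> \<open>As the queue held at most \<open>B\<close> packets, an overfull
        \<open>?S\<close> means a full queue and an arrival, so the minimum has rank
        \<open>B + 1\<close>.\<close>
      then show ?thesis using dep' l nc cardS True le tag_Min[OF fin ne]
        by (cases "arr t") (auto simp: t ind_def)
    next
      case False
      then have "Q t = ?S" using Qt by simp
      moreover from this have "?los = None" using los by (cases ?los) auto
      ultimately show ?thesis using dep' nc cardS False le by (cases "arr t") (auto simp: t ind_def)
    qed
  qed
qed

end

lemma ex_optical_pq:
  "\<exists>d (pol :: nat \<Rightarrow> (nat \<Rightarrow> 'p::linorder option) \<Rightarrow> (nat \<Rightarrow> bool) \<Rightarrow> nat \<Rightarrow> nat).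
     optical_pq ((L + 1) * (3001 * L + 7000)) (2 ^ L) d pol"
proof -
  define M where "M = (L + 1) * (3001 * L + 7000)"
  define B where "B = (2::nat) ^ L"
  have "card {1..M} = card (fibers L)" "finite (fibers L)"
    using card_fibers[of L] by (simp_all add: M_def)
  then obtain dec where dec: "bij_betw dec {1..M} (fibers L)"
    using finite_same_card_bij[of "{1..M}" "fibers L"] by auto
  define d where "d j = fiber_delay (dec j)" for j
  obtain F :: "(nat \<Rightarrow> 'p option) \<Rightarrow> (nat \<Rightarrow> bool) \<Rightarrow> nat \<Rightarrow> 'p \<Rightarrow> journey option" where
    causal: "\<And>arr arr' c c' t. (\<forall>s\<le>t. arr s = arr' s \<and> c s = c' s) \<Longrightarrow> F arr c t = F arr' c' t"
    and steps: "\<And>arr c t. admissible_arrivals arr \<Longrightarrow> schedule_step B arr c (F arr c) t"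
    using ex_causal_schedule[of B] by blast
  define hp where "hp arr c t p j \<longleftrightarrow> j \<in> {1..M} \<and> hop (F arr c) t p (dec j)" for arr c t p j
  define pol where "pol t arr c = switching M B d arr c (hp arr c) t" for t arr c
  have d_pos: "0 < d j" if "j \<in> {1..M}" for j
    unfolding d_def using bij_betwE[OF dec] that by (intro fiber_delay_pos) blast
  have "pq_behaviour M B d (\<lambda>t. pol t arr c) arr c" if adm: "admissible_arrivals arr" for arr c
  proof -
    interpret fs: full_schedule B arr c "F arr c"
      by unfold_locales (use adm steps in auto)
    interpret nw: network M B d arr c "hp arr c"
    proof
      fix t p assume "p \<in> queue B arr c t"
      then obtain s f where s: "hop (F arr c) s p f" "s \<le> t" "t < s + fiber_delay f"
        using fs.hop_covers by blast
      then have "f \<in> fibers L" using fs.hop_fiber B_def by blast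
      then obtain j where "j \<in> {1..M}" "f = dec j"
        using bij_betw_imp_surj_on[OF dec] by blast
      then show "\<exists>s j. hp arr c s p j \<and> s \<le> t \<and> t < s + d j"
        using s by (intro exI[of _ s] exI[of _ j]) (simp add: hp_def d_def)
    next
      fix t t' p j j' assume h: "hp arr c t p j" "hp arr c t' p j'" and "t \<le> t'" "t' < t + d j"
      then have "t = t' \<and> dec j = dec j'"
        by (intro fs.hop_disjoint[of t p]) (simp_all add: hp_def d_def)
      then show "t = t' \<and> j = j'"
        using h inj_onD[OF bij_betw_imp_inj_on[OF dec], of j j'] by (simp add: hp_def)
    next
      fix t p j u assume "hp arr c t p j" "t \<le> u" "u < t + d j"
      then show "p \<in> queue B arr c u"
        by (intro fs.hop_in_queue[of t p "dec j"]) (simp_all add: hp_def d_def)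
    next
      fix t p q j assume "hp arr c t p j" "hp arr c t q j"
      then show "p = q" by (intro fs.hop_injective[of t p "dec j"]) (simp_all add: hp_def)
    next
      show "j \<in> {1..M}" if "hp arr c t p j" for t p j using that by (simp add: hp_def)
    qed (fact adm d_pos)+
    show ?thesis using nw.pq_behaviour by (simp add: pol_def)
  qed
  moreover have "pol t arr c k = pol t arr' c' k" if "\<forall>s\<le>t. arr s = arr' s \<and> c s = c' s" for t arr arr' c c' k
  proof -
    have F: "F arr c s = F arr' c' s" if "s \<le> t" for s
      by (rule causal) (use that \<open>\<forall>s\<le>t. _\<close> in auto)
    have "hp arr c s = hp arr' c' s" if "s \<le> t" for s
    proof -
      have "hop (F arr c) s p f = hop (F arr' c') s p f" for p f
        by (rule hop_cong) (use F that in simp)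
      then show ?thesis by (intro ext) (simp add: hp_def)
    qed
    then have "switching M B d arr c (hp arr c) t = switching M B d arr' c' (hp arr' c') t"
      using that by (intro switching_cong) simp
    then show ?thesis by (simp add: pol_def)
  qed
  ultimately have "optical_pq M B d pol"
    using d_pos bij_permutation_extending unfolding optical_pq_def pol_def switching_def by blast
  then show ?thesis unfolding M_def B_def by blast
qed

text \<open>The networks exist for \<open>M = (L + 1) * (3001 * L + 7000)\<close> with buffer
  \<open>2 ^ L\<close>; since \<open>M\<close> is quadratic in \<open>L\<close>, the exponent
  \<open>L\<close> is of order \<open>sqrt M\<close>.\<close>

theorem theorem3:
  "\<exists>Ms :: nat set. \<exists>Bf :: nat \<Rightarrow> nat. \<exists>c1 c2 :: real.
     infinite Ms \<and> 0 < c1 \<and> 0 < c2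
   \<and> (\<forall>M \<in> Ms. \<exists>d (pol :: nat \<Rightarrow> (nat \<Rightarrow> 'p::linorder option) \<Rightarrow> (nat \<Rightarrow> bool) \<Rightarrow> nat \<Rightarrow> nat).
         optical_pq M (Bf M) d pol)
   \<and> (\<exists>N. \<forall>M \<in> Ms. N \<le> M \<longrightarrow>
         2 powr (c1 * sqrt (real M)) \<le> real (Bf M) \<and> real (Bf M) \<le> 2 powr (c2 * sqrt (real M)))"
proof -
  define size where "size L = (L + 1) * (3001 * L + 7000)" for L :: nat
  have mono: "strict_mono size"
    by (rule strict_monoI) (unfold size_def, rule mult_strict_mono, simp_all)
  then have inj: "inj size" by (rule strict_mono_imp_inj_on)
  \<comment> \<open>The buffer must be a function of \<open>M\<close>, so \<open>L\<close> is
    recovered by inverting the injective \<open>size\<close>.\<close>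
  define Bf where "Bf M = (2::nat) ^ inv size M" for M
  have Bf: "Bf (size L) = 2 ^ L" for L by (simp add: Bf_def inj)
  have pq: "\<forall>M\<in>range size. \<exists>d (pol :: nat \<Rightarrow> (nat \<Rightarrow> 'p option) \<Rightarrow> (nat \<Rightarrow> bool) \<Rightarrow> nat \<Rightarrow> nat).
      optical_pq M (Bf M) d pol"
    using ex_optical_pq by (auto simp: Bf) (simp add: size_def)
  \<comment> \<open>For \<open>L\<close> at least 1 the size is at most \<open>20002 * L^2\<close>,
    below \<open>(200 * L)^2\<close>, whence \<open>1 / 200\<close>. At \<open>L = 0\<close> the
    lower bound fails, the buffer being 1 and the size 7000.\<close>
  have bounds: "2 powr (1 / 200 * sqrt (real (size L))) \<le> real (Bf (size L)) \<and>
      real (Bf (size L)) \<le> 2 powr (1 * sqrt (real (size L)))" if "size 1 \<le> size L" for L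
  proof -
    have L: "1 \<le> L" using that strict_mono_less_eq[OF mono] by blast
    have "size L \<le> (2 * L) * (10001 * L)"
      unfolding size_def using L by (intro mult_le_mono) simp_all
    also have "\<dots> \<le> (200 * L)\<^sup>2" by (simp add: power2_eq_square)
    finally have "real (size L) \<le> (200 * real L)\<^sup>2"
      using of_nat_mono[of "size L" "(200 * L)\<^sup>2", where 'a = real] by simp
    then have lower: "1 / 200 * sqrt (real (size L)) \<le> real L"
      using real_le_lsqrt[of "200 * real L" "real (size L)"] by simp
    have "L * L \<le> size L" unfolding size_def by (intro mult_le_mono) simp_all
    then have "(real L)\<^sup>2 \<le> real (size L)"
      using of_nat_mono[of "L * L" "size L", where 'a = real] by (simp add: power2_eq_square)
    then have upper: "real L \<le> 1 * sqrt (real (size L))"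
      by (simp add: real_le_rsqrt)
    have "real (Bf (size L)) = 2 powr real L" by (simp add: Bf powr_realpow)
    then show ?thesis using lower upper by simp
  qed
  have "infinite (range size)" using inj finite_imageD[of size UNIV] infinite_UNIV_nat by blast
  then show ?thesis
    using pq bounds
    by (intro exI[of _ "range size"] exI[of _ Bf] exI[of _ "1 / 200"] exI[of _ 1] conjI
        exI[of _ "size 1"]) auto
qed

end
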